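(* (a) Let $0<p<1/2$. There exists a martingale $f\in H_{p}(G_{m})$ such that \[ \omega\left(\frac{1}{M_{N}},f\right)_{H_{p}}=O\left(\frac{1}{M_{N}^{1/p-2}}\right)\quad\text{as } N\rightarrow\infty \] and \[ \left\Vert \sigma_{n}f-f\right\Vert_{L_{p,\infty}}\nrightarrow 0\quad\text{as } n\rightarrow\infty . \] (b) There exists a martingale $f\in H_{1/2}(G_{m})$ such that \[ \omega\left(\frac{1}{M_{N}},f\right)_{H_{1/2}}=O\left(\frac{1}{N^{2}}\right)\quad\text{as } N\rightarrow\infty \] and \[ \left\Vert \sigma_{n}f-f\right\Vert_{1/2}\nrightarrow 0\quad\text{as } n\rightarrow\infty . \]
   Context: Let $m=(m_0,m_1,\dots)$ be a bounded sequence of integers with $m_k\ge 2$ (bounded Vilenkin group). $G_m$ is the complete direct product of the cyclic groups $Z_{m_k}=\{0,\dots,m_k-1\}$ with the product topology and product Haar measure $\mu$ (each point of $Z_{m_k}$ has mass $1/m_k$), so $\mu(G_m)=1$. Put $M_0=1$, $M_{k+1}=m_kM_k$. Every $n\in\mathbb{N}$ is uniquely $n=\sum_j n_jM_j$ with $n_j\in Z_{m_j}$. The generalized Rademacher functions are $r_k(x)=\exp(2\pi\iota x_k/m_k)$ for $x=(x_0,x_1,\dots)\in G_m$, and the Vilenkin system is $\psi_n=\prod_k r_k^{n_k}$. For $x\in G_m$, $I_n(x)=\{y\in G_m: y_j=x_j,\ j<n\}$, and $\digamma_n$ is the $\sigma$-algebra generated by $\{I_n(x):x\in G_m\}$. For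 a martingale $f=(f^{(n)})$ with respect to $(\digamma_n)$, the maximal function is $f^*=\sup_n|f^{(n)}|$ and for $0<p<\infty$, $H_p(G_m)$ is the space of martingales with $\|f\|_{H_p}:=\|f^*\|_p<\infty$, where $\|g\|_p=(\int_{G_m}|g|^pd\mu)^{1/p}$. The weak quasinorm is $\|g\|_{L_{p,\infty}}=\sup_{\lambda>0}\lambda^p\mu(|g|>\lambda)$. The Fourier coefficients of a martingale are $\widehat f(i)=\lim_{k\to\infty}\int_{G_m}f^{(k)}\overline{\psi_i}\,d\mu$, the partial sums are $S_nf=\sum_{k=0}^{n-1}\widehat f(k)\psi_k$ ($S_0f=0$), and the Fejér means are $\sigma_nf=\frac1n\sum_{k=1}^nS_kf$. The modulus of continuity in $H_p$ is $\omega(1/M_n,f)_{H_p}:=\|f-S_{M_n}f\|_{H_p}$. *)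

theory Defs
  imports "HOL-Probability.Probability"
begin

definition enn_powr :: "ennreal \<Rightarrow> real \<Rightarrow> ennreal" where
  "enn_powr x a = (if x = \<infinity> then \<infinity> else ennreal (enn2real x powr a))"

definition Mseq :: "(nat \<Rightarrow> nat) \<Rightarrow> nat \<Rightarrow> nat" where
  "Mseq m n = (\<Prod>k<n. m k)"

text \<open>The Vilenkin group G_m with its product Haar measure: points are
  sequences x with x k in Z_(m k), each point of Z_(m k) has mass 1/(m k).\<close>
definition Gm :: "(nat \<Rightarrow> nat) \<Rightarrow> (nat \<Rightarrow> nat) measure" where
  "Gm m = (\<Pi>\<^sub>M k\<in>UNIV. uniform_count_measure {..<m k})"

definition digit :: "(nat \<Rightarrow> nat) \<Rightarrow> nat \<Rightarrow> nat \<Rightarrow> nat" where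
  "digit m n j = (n div Mseq m j) mod m j"

definition rademacher :: "(nat \<Rightarrow> nat) \<Rightarrow> nat \<Rightarrow> (nat \<Rightarrow> nat) \<Rightarrow> complex" where
  "rademacher m k x = cis (2 * pi * real (x k) / real (m k))"

text \<open>Vilenkin function psi_n; digits n_k vanish for k \<ge> n since M_k \<ge> 2^k > n.\<close>
definition vilenkin :: "(nat \<Rightarrow> nat) \<Rightarrow> nat \<Rightarrow> (nat \<Rightarrow> nat) \<Rightarrow> complex" where
  "vilenkin m n x = (\<Prod>k<n. rademacher m k x ^ digit m n k)"

definition Icyl :: "(nat \<Rightarrow> nat) \<Rightarrow> nat \<Rightarrow> (nat \<Rightarrow> nat) \<Rightarrow> (nat \<Rightarrow> nat) set" where
  "Icyl m n x = {y \<in> space (Gm m). \<forall>j<n. y j = x j}"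

text \<open>Martingales with respect to (F_n): F n is F_n-measurable (constant on
  each atom I_n(x)), and E(F (n+1) | F_n) = F n, i.e. F n is the average of
  F (n+1) over the m_n sub-cylinders.\<close>
definition is_martingale :: "(nat \<Rightarrow> nat) \<Rightarrow> (nat \<Rightarrow> (nat \<Rightarrow> nat) \<Rightarrow> complex) \<Rightarrow> bool" where
  "is_martingale m F \<longleftrightarrow>
     (\<forall>n x y. x \<in> space (Gm m) \<longrightarrow> y \<in> space (Gm m) \<longrightarrow> (\<forall>j<n. x j = y j) \<longrightarrow> F n x = F n y) \<and>
     (\<forall>n x. x \<in> space (Gm m) \<longrightarrow>
        F n x = (\<Sum>j<m n. F (Suc n) (x(n := j))) / of_nat (m n))"

definition cond_exp_k :: "(nat \<Rightarrow> nat) \<Rightarrow> nat \<Rightarrow> ((nat \<Rightarrow> nat) \<Rightarrow> complex) \<Rightarrow> (nat \<Rightarrow> nat) \<Rightarrow> complex" where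
  "cond_exp_k m k g x =
     of_nat (Mseq m k) * (\<integral>y. indicator (Icyl m k x) y *\<^sub>R g y \<partial>Gm m)"

definition maximal_fn :: "(nat \<Rightarrow> (nat \<Rightarrow> nat) \<Rightarrow> complex) \<Rightarrow> (nat \<Rightarrow> nat) \<Rightarrow> ennreal" where
  "maximal_fn F x = (SUP n. ennreal (norm (F n x)))"

definition Hp_norm :: "(nat \<Rightarrow> nat) \<Rightarrow> real \<Rightarrow> (nat \<Rightarrow> (nat \<Rightarrow> nat) \<Rightarrow> complex) \<Rightarrow> ennreal" where
  "Hp_norm m p F = enn_powr (\<integral>\<^sup>+ x. enn_powr (maximal_fn F x) p \<partial>Gm m) (1 / p)"

definition Lp_norm :: "(nat \<Rightarrow> nat) \<Rightarrow> real \<Rightarrow> ((nat \<Rightarrow> nat) \<Rightarrow> complex) \<Rightarrow> ennreal" where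
  "Lp_norm m p g = enn_powr (\<integral>\<^sup>+ x. ennreal (norm (g x) powr p) \<partial>Gm m) (1 / p)"

definition weak_Lp_norm :: "(nat \<Rightarrow> nat) \<Rightarrow> real \<Rightarrow> ((nat \<Rightarrow> nat) \<Rightarrow> complex) \<Rightarrow> ennreal" where
  "weak_Lp_norm m p g =
     (SUP t\<in>{0<..}. ennreal (t powr p) * emeasure (Gm m) {x \<in> space (Gm m). t < norm (g x)})"

definition fourier_coeff :: "(nat \<Rightarrow> nat) \<Rightarrow> (nat \<Rightarrow> (nat \<Rightarrow> nat) \<Rightarrow> complex) \<Rightarrow> nat \<Rightarrow> complex" where
  "fourier_coeff m F i = lim (\<lambda>k. \<integral>x. F k x * cnj (vilenkin m i x) \<partial>Gm m)"

definition partial_sum :: "(nat \<Rightarrow> nat) \<Rightarrow> (nat \<Rightarrow> (nat \<Rightarrow> nat) \<Rightarrow> complex) \<Rightarrow> nat \<Rightarrow> (nat \<Rightarrow> nat) \<Rightarrow> complex" where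
  "partial_sum m F n x = (\<Sum>k<n. fourier_coeff m F k * vilenkin m k x)"

definition fejer_mean :: "(nat \<Rightarrow> nat) \<Rightarrow> (nat \<Rightarrow> (nat \<Rightarrow> nat) \<Rightarrow> complex) \<Rightarrow> nat \<Rightarrow> (nat \<Rightarrow> nat) \<Rightarrow> complex" where
  "fejer_mean m F n x = (\<Sum>k=1..n. partial_sum m F k x) / of_nat n"

text \<open>Modulus of continuity omega(1/M_n, f)_{H_p} = ||f - S_{M_n} f||_{H_p}, where
  the martingale f - S_{M_n} f has k-th term f^(k) - E(S_{M_n} f | F_k).\<close>
definition modulus_Hp :: "(nat \<Rightarrow> nat) \<Rightarrow> real \<Rightarrow> nat \<Rightarrow> (nat \<Rightarrow> (nat \<Rightarrow> nat) \<Rightarrow> complex) \<Rightarrow> ennreal" where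
  "modulus_Hp m p n F =
     Hp_norm m p (\<lambda>k x. F k x - cond_exp_k m k (partial_sum m F (Mseq m n)) x)"

end

theory Submission
  imports Defs
begin

text \<open>
  Both martingales have the form f = \<Sum>_k l_k M_k (D_{M_{k+1}} - D_{M_k}), where
  D_{M_k} = \<Sum>_{j<M_k} \<psi>_j = M_k 1_{I_k(0)}; hence the Fourier coefficients equal l_k M_k on
  [M_k, M_{k+1}). Since p \<le> 1, the p-th power of the maximal function of f - S_{M_N} f is at most
  \<Sum>_{k\<ge>N} (B l_k M_k^2)^p 1_{I_k(0)} with B a bound of m, whose integral is
  B^p \<Sum>_{k\<ge>N} l_k^p M_k^{2p-1}. For (a) take l_k = 1; for (b) let l_k = 1/k^2 if k is a power
  of two and l_k = 0 otherwise.

  For the divergence put E_n = n (\<sigma>_n f - f). In E_{n+2h} - 2 E_{n+h} + E_n the function f cancels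
  and what is left is a sum of h^2 terms of the Fourier series with indices strictly between n and
  n+2h. If these indices lie in one block [w, w + M_s) with M_s dividing w and M_k \<le> w < M_{k+1},
  then on I_s(0) all these terms coincide and the sum has modulus l_k M_k h^2. With h = 1 and
  w = M_k this forces one of three consecutive \<sigma>_n f - f to be large in (a). In (b) take h close to
  M_s/4 and average over M_k \<le> n < 2 M_k: every shell I_s - I_{s+1} with 2 \<le> s < k contributes at
  least a constant times 1/k to the mean of the integrals of |\<sigma>_n f - f|^{1/2}, which therefore
  stays away from 0.
\<close>

section \<open>Elementary inequalities and finite sums\<close>

lemma sum_blocks:
  fixes g :: "nat \<Rightarrow> 'a :: comm_monoid_add"
  shows "(\<Sum>j<n * k. g j) = (\<Sum>a<n. \<Sum>b<k. g (a * k + b))"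
  by (simp add: sum.nat_group[symmetric] sum.atLeastLessThan_shift_0[of g "_ * k"] atLeast0LessThan)

text \<open>Each summand is at most the whole and t^(p-1) is nonincreasing, so a (a+b)^(p-1) \<le>
  a^p, and likewise for b.\<close>

lemma powr_add_le:
  fixes a b p :: real
  assumes "0 \<le> a" "0 \<le> b" "0 < p" "p \<le> 1"
  shows "(a + b) powr p \<le> a powr p + b powr p"
proof (cases "a = 0 \<or> b = 0")
  case False
  then have ab: "0 < a" "0 < b" using assms by auto
  have *: "c * (a + b) powr (p - 1) \<le> c powr p" if "0 < c" "c \<le> a + b" for c
  proof -
    have "c * (a + b) powr (p - 1) \<le> c * c powr (p - 1)"
      using that assms by (intro mult_left_mono powr_mono2') auto
    also have "\<dots> = c powr p" using that by (simp add: powr_diff)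
    finally show ?thesis .
  qed
  have "(a + b) powr p = (a + b) * (a + b) powr (p - 1)"
    using ab by (simp add: powr_diff)
  also have "\<dots> = a * (a + b) powr (p - 1) + b * (a + b) powr (p - 1)"
    by (simp add: distrib_right)
  also have "\<dots> \<le> a powr p + b powr p"
    using *[of a] *[of b] ab by simp
  finally show ?thesis .
qed auto

lemma powr_sum_le:
  fixes f :: "'a \<Rightarrow> real"
  assumes "finite A" "\<And>i. i \<in> A \<Longrightarrow> 0 \<le> f i" "0 < p" "p \<le> 1"
  shows "(\<Sum>i\<in>A. f i) powr p \<le> (\<Sum>i\<in>A. f i powr p)"
  using assms(1,2)
proof (induction rule: finite_induct)
  case (insert i A)
  have "(f i + sum f A) powr p \<le> f i powr p + sum f A powr p"
    using insert assms by (intro powr_add_le sum_nonneg) auto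
  then show ?case using insert by auto
qed simp

text \<open>A finite \<open>R\<close> forces every \<open>a n\<close> below R^(1/p), so the supremum
  is finite too and the claim becomes an inequality between real powers.\<close>

lemma enn_powr_SUP_le:
  fixes a :: "nat \<Rightarrow> real"
  assumes "\<And>n. 0 \<le> a n" "\<And>n. ennreal (a n powr p) \<le> R" "0 < p"
  shows "enn_powr (SUP n. ennreal (a n)) p \<le> R"
proof (cases "R = \<infinity>")
  case False
  then obtain r where r: "R = ennreal r" "0 \<le> r" by (cases R) auto
  have "a n \<le> r powr (1 / p)" for n
  proof -
    have "a n powr p \<le> r" using assms(2)[of n] r by simp
    then have "(a n powr p) powr (1 / p) \<le> r powr (1 / p)"
      using assms(3) by (intro powr_mono2) auto
    then show ?thesis using assms(1)[of n] assms(3) by (simp add: powr_powr)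
  qed
  then have le: "(SUP n. ennreal (a n)) \<le> ennreal (r powr (1 / p))"
    by (intro SUP_least ennreal_leI)
  then obtain t where t: "(SUP n. ennreal (a n)) = ennreal t" "0 \<le> t"
    by (cases "SUP n. ennreal (a n)") (auto simp: top_unique)
  then have "t \<le> r powr (1 / p)" using le by simp
  then have "t powr p \<le> (r powr (1 / p)) powr p"
    using t assms(3) by (intro powr_mono2) auto
  then show ?thesis using t r assms(3) by (simp add: enn_powr_def powr_powr)
qed simp

lemma enn_powr_le:
  assumes "x \<le> ennreal A" "0 \<le> A" "0 \<le> q"
  shows "enn_powr x q \<le> ennreal (A powr q)"
proof -
  obtain t where t: "x = ennreal t" "0 \<le> t"
    using assms(1) by (cases x) (auto simp: top_unique)
  then show ?thesis using assms by (auto simp: enn_powr_def intro: ennreal_leI powr_mono2)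
qed

text \<open>The first difference E(k+h) - E(k) is a sum of h consecutive partial sums minus h c.
  Differencing again cancels c and pairs partial sums whose indices differ by h, so only
  coefficients with indices from n+1 to n+2h-1 survive.\<close>

lemma second_difference_sums:
  fixes a :: "nat \<Rightarrow> complex" and c :: complex
  defines "E \<equiv> \<lambda>n. (\<Sum>k=1..n. \<Sum>j<k. a j) - of_nat n * c"
  shows "E (n + 2 * h) - 2 * E (n + h) + E n = (\<Sum>i<h. \<Sum>j<h. a (n + i + j + 1))"
proof -
  define S where "S k = (\<Sum>j<k. a j)" for k
  have shift: "E (k + h) = E k + (\<Sum>i<h. S (k + i + 1)) - of_nat h * c" for k
    by (induction h) (auto simp: E_def S_def algebra_simps)
  have S: "S (k + h) = S k + (\<Sum>j<h. a (k + j))" for k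
    by (induction h) (auto simp: S_def)
  have "(\<Sum>i<h. S (n + h + i + 1)) = (\<Sum>i<h. S (n + i + 1 + h))"
    by (intro sum.cong refl arg_cong[where f=S]) simp
  moreover have "n + 2 * h = n + h + h" by simp
  ultimately have "E (n + 2 * h) = E (n + h) + (\<Sum>i<h. S (n + i + 1 + h)) - of_nat h * c"
    using shift[of "n + h"] by (simp only:)
  then have "E (n + 2 * h) - 2 * E (n + h) + E n = (\<Sum>i<h. S (n + i + 1 + h) - S (n + i + 1))"
    using shift[of n] by (simp add: sum_subtractf)
  also have "\<dots> = (\<Sum>i<h. \<Sum>j<h. a (n + i + 1 + j))"
    by (simp only: S add_diff_cancel_left')
  also have "\<dots> = (\<Sum>i<h. \<Sum>j<h. a (n + i + j + 1))"
    by simp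
  finally show ?thesis .
qed

text \<open>The binary logarithm rounded up, with value 0 at 0. Passing from k to k+1 changes it
  exactly when k is a power of two, so differences of functions of it can be supported on powers of
  two.\<close>

definition pow2_ceil_exp :: "nat \<Rightarrow> nat" where
  "pow2_ceil_exp N = (LEAST i. N \<le> 2 ^ i)"

lemma le_pow2_ceil_exp: "N \<le> 2 ^ pow2_ceil_exp N"
  unfolding pow2_ceil_exp_def by (rule LeastI[of _ N]) (simp add: less_imp_le)

lemma pow2_ceil_exp_le: "N \<le> 2 ^ i \<Longrightarrow> pow2_ceil_exp N \<le> i"
  unfolding pow2_ceil_exp_def by (rule Least_le)

lemma pow2_ceil_exp_eqs: "pow2_ceil_exp (2 ^ i) = i" "pow2_ceil_exp (Suc (2 ^ i)) = Suc i"
proof -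
  show "pow2_ceil_exp (2 ^ i) = i"
    using pow2_ceil_exp_le[of "2 ^ i" i] le_pow2_ceil_exp[of "2 ^ i"]
    by (simp add: power_increasing_iff le_antisym)
  have "(2::nat) ^ i < 2 ^ pow2_ceil_exp (Suc (2 ^ i))"
    using le_pow2_ceil_exp[of "Suc (2 ^ i)"] by (simp only: Suc_le_eq)
  then have "Suc i \<le> pow2_ceil_exp (Suc (2 ^ i))"
    by simp
  moreover have "Suc (2 ^ i) \<le> 2 ^ Suc i" by simp
  ultimately show "pow2_ceil_exp (Suc (2 ^ i)) = Suc i"
    using pow2_ceil_exp_le[of "Suc (2 ^ i)" "Suc i"] by (simp only: le_antisym)
qed

section \<open>Vilenkin functions\<close>

locale vilenkin_group =
  fixes m :: "nat \<Rightarrow> nat"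
  assumes m_ge2: "\<And>k. 2 \<le> m k"
begin

abbreviation "M \<equiv> Mseq m"

lemma m_pos [simp]: "0 < m k" "m k \<noteq> 0"
  using m_ge2[of k] by simp_all

lemma M_0 [simp]: "M 0 = 1"
  by (simp add: Mseq_def)

lemma M_Suc: "M (Suc k) = m k * M k"
  by (simp add: Mseq_def mult.commute)

lemma M_pos [simp]: "0 < M k" "M k \<noteq> 0"
  by (simp_all add: Mseq_def)

lemma M_dvd: "i \<le> j \<Longrightarrow> M i dvd M j"
  by (induction j rule: dec_induct) (auto simp: M_Suc)

lemma M_mono: "i \<le> j \<Longrightarrow> M i \<le> M j"
  by (meson M_dvd M_pos dvd_imp_le)

lemma M_add_ge: "2 ^ i * M k \<le> M (k + i)"
proof (induction i)
  case (Suc i)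
  have "2 ^ Suc i * M k \<le> 2 * M (k + i)" using Suc by simp
  also have "\<dots> \<le> M (k + Suc i)" using m_ge2 by (simp add: M_Suc)
  finally show ?case .
qed simp

lemma two_power_le_M: "2 ^ i \<le> M i"
  using M_add_ge[of i 0] by simp

lemma less_M: "n < M n"
  using two_power_le_M[of n] less_exp[of n] by linarith

section \<open>Product measure and integrals of coordinatewise products\<close>

lemma space_Gm: "space (Gm m) = {x. \<forall>k. x k < m k}"
  by (auto simp: Gm_def space_PiM space_uniform_count_measure PiE_def Pi_def)

lemma zero_in_space [simp]: "(\<lambda>_. 0) \<in> space (Gm m)"
  by (simp add: space_Gm)

lemma product_prob_space_uniform:
  "product_prob_space (\<lambda>k. uniform_count_measure {..<m k})"
  by (intro product_prob_spaceI prob_space_uniform_count_measure) (auto simp: lessThan_empty_iff)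

sublocale Gm: prob_space "Gm m"
  unfolding Gm_def
  by (intro prob_space_PiM prob_space_uniform_count_measure) (auto simp: lessThan_empty_iff)

lemma measurable_coord [measurable]:
  fixes h :: "nat \<Rightarrow> 'a :: topological_space"
  shows "(\<lambda>x. h (x i)) \<in> borel_measurable (Gm m)"
proof (rule measurable_compose[where f="\<lambda>x. x i" and N="uniform_count_measure {..<m i}"])
  show "(\<lambda>x. x i) \<in> Gm m \<rightarrow>\<^sub>M uniform_count_measure {..<m i}"
    unfolding Gm_def by (rule measurable_component_singleton) simp
  show "h \<in> borel_measurable (uniform_count_measure {..<m i})"
    by (auto simp: measurable_def sets_uniform_count_measure space_uniform_count_measure)
qed

text \<open>The integrand depends on the first \<open>K\<close> coordinates only. Projecting onto
  them reduces the claim to Fubini for finitely many normalized counting measures.\<close>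

lemma integral_prod_coord:
  fixes h :: "nat \<Rightarrow> nat \<Rightarrow> complex"
  shows "(\<integral>x. (\<Prod>i<K. h i (x i)) \<partial>Gm m) = (\<Prod>i<K. (\<Sum>t<m i. h i t) / of_nat (m i))"
proof -
  let ?U = "\<lambda>k. uniform_count_measure {..<m k}"
  interpret P: product_prob_space ?U UNIV
    by (rule product_prob_space_uniform)
  have meas: "h i \<in> borel_measurable (?U i)" for i
    by (auto simp: measurable_def sets_uniform_count_measure space_uniform_count_measure)
  have int: "integrable (?U i) (h i)" for i
    unfolding uniform_count_measure_def by (rule integrable_point_measure_finite) auto
  have "(\<Prod>i<K. (\<Sum>t<m i. h i t) / of_nat (m i)) = (\<Prod>i<K. integral\<^sup>L (?U i) (h i))"
    by (simp add: uniform_count_measure_def lebesgue_integral_point_measure_finite sum_divide_distrib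
        scaleR_conv_of_real)
  also have "\<dots> = (\<integral>x. (\<Prod>i<K. h i (x i)) \<partial>PiM {..<K} ?U)"
    by (rule P.product_integral_prod[symmetric]) (auto intro: int)
  also have "\<dots> = (\<integral>x. (\<Prod>i<K. h i (x i)) \<partial>distr (PiM UNIV ?U) (PiM {..<K} ?U) (\<lambda>x. restrict x {..<K}))"
    by (subst P.distr_PiM_restrict_finite) auto
  also have "\<dots> = (\<integral>x. (\<Prod>i<K. h i (restrict x {..<K} i)) \<partial>PiM UNIV ?U)"
  proof (rule integral_distr)
    show "(\<lambda>x. \<Prod>i<K. h i (x i)) \<in> borel_measurable (PiM {..<K} ?U)"
      by (intro borel_measurable_prod measurable_compose[OF measurable_component_singleton]) (auto intro: meas)
  qed (rule measurable_restrict_subset, simp)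
  also have "\<dots> = (\<integral>x. (\<Prod>i<K. h i (x i)) \<partial>Gm m)"
    unfolding Gm_def by (intro Bochner_Integration.integral_cong refl prod.cong) auto
  finally show ?thesis by simp
qed

section \<open>Mixed-radix digits and the characters they determine\<close>

lemma mod_M_Suc:
  "n mod M (Suc k) = n mod M k + M k * digit m n k"
  unfolding digit_def M_Suc by (metis mod_mult2_eq mult.commute add.commute)

lemma digit_eq_0: "n < M k \<Longrightarrow> k \<le> i \<Longrightarrow> digit m n i = 0"
  using M_mono[of k i] by (simp add: digit_def)

lemma digits_eq_0_imp_less:
  assumes "n < M K" "\<And>i. k \<le> i \<Longrightarrow> i < K \<Longrightarrow> digit m n i = 0"
  shows "n < M k"
proof (cases "K \<le> k")
  case True
  then show ?thesis using assms(1) M_mono[of K k] by simp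
next
  case False
  then have "k \<le> K" by simp
  then have "n mod M K = n mod M k"
    using assms(2)
    by (induction K rule: dec_induct) (auto simp: mod_M_Suc)
  then show ?thesis using assms(1) by (metis M_pos mod_less mod_less_divisor)
qed

text \<open>The range of the product in the definition varies with the index. Digits further out
  vanish, so any common long range may be used and characters of different indices compared factor
  by factor.\<close>

lemma vilenkin_eq_prod:
  assumes "n < M K"
  shows "vilenkin m n x = (\<Prod>k<K. rademacher m k x ^ digit m n k)"
proof -
  let ?g = "\<lambda>k. rademacher m k x ^ digit m n k"
  have "(\<Prod>k<n. ?g k) = (\<Prod>k<max n K. ?g k)"
    by (rule prod.mono_neutral_left) (auto simp: digit_eq_0[OF less_M])
  also have "\<dots> = (\<Prod>k<K. ?g k)"
    by (rule prod.mono_neutral_right) (auto simp: digit_eq_0[OF assms])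
  finally show ?thesis by (simp add: vilenkin_def)
qed

lemma norm_vilenkin [simp]: "norm (vilenkin m n x) = 1"
  by (simp add: vilenkin_def rademacher_def norm_power flip: prod_norm)

lemma measurable_rademacher [measurable]: "rademacher m k \<in> borel_measurable (Gm m)"
  unfolding rademacher_def[abs_def] by (rule measurable_coord)

lemma measurable_vilenkin [measurable]: "vilenkin m n \<in> borel_measurable (Gm m)"
  unfolding vilenkin_def[abs_def] by measurable

text \<open>For a \<noteq> 0 this is a geometric sum whose ratio is an m_k-th root of unity,
  different from 1 because m_k does not divide a.\<close>

lemma sum_rademacher_powers:
  assumes "a < m k"
  shows "(\<Sum>t<m k. cis (2 * pi * real t / real (m k)) ^ a) = (if a = 0 then of_nat (m k) else 0)"
proof (cases "a = 0")
  case False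
  let ?z = "cis (2 * pi * real a / real (m k))"
  have "?z \<noteq> 1"
  proof
    assume "?z = 1"
    moreover have "exp (2 * of_real pi * \<i> * of_nat a / of_nat (m k)) = ?z"
      by (simp add: cis_conv_exp mult_ac)
    ultimately have "m k dvd a"
      using complex_root_unity_eq_1[of "m k" a] m_pos(1)[of k] by simp
    then show False using assms False by (auto dest: dvd_imp_le)
  qed
  moreover have "?z ^ m k = 1"
    using cis_multiple_2pi[of "real a"] by (simp only: Complex.DeMoivre) simp
  moreover have "(\<Sum>t<m k. cis (2 * pi * real t / real (m k)) ^ a) = (\<Sum>t<m k. ?z ^ t)"
    by (intro sum.cong) (auto simp: Complex.DeMoivre mult_ac)
  ultimately show ?thesis using False by (simp add: geometric_sum)
qed simp

section \<open>Cylinders and conditional expectations of characters\<close>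

lemma measurable_Icyl [measurable]: "Icyl m k x \<in> sets (Gm m)"
proof -
  have [measurable]: "Measurable.pred (Gm m) (\<lambda>y. y j = x j)" for j
  proof -
    \<comment> \<open>The equality is recast through a real function of one coordinate so that
      \<open>measurable_coord\<close> applies.\<close>
    have "Measurable.pred (Gm m) (\<lambda>y. (of_bool (y j = x j) :: real) = 1)"
      by measurable
    then show ?thesis by simp
  qed
  show ?thesis unfolding Icyl_def by measurable
qed

text \<open>The integrand factors over coordinates. For i < k the cylinder pins y_i to x_i; for i
  \<ge> k orthogonality leaves 1 if the i-th digit of j vanishes and 0 otherwise. All these digits
  vanish exactly when j < M_k.\<close>

lemma cond_exp_vilenkin:
  assumes "x \<in> space (Gm m)"
  shows "cond_exp_k m k (vilenkin m j) x = (if j < M k then vilenkin m j x else 0)"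
proof -
  \<comment> \<open>Large enough for the coordinates fixed by the cylinder and for all nonzero
    digits of \<open>j\<close>.\<close>
  define K where "K = max k j"
  have jK: "j < M K" using less_M[of j] M_mono[of j K] by (simp add: K_def)
  have kK: "k \<le> K" by (simp add: K_def)
  define h where "h i t = (if i < k then of_bool (t = x i) else 1) *
      cis (2 * pi * real t / real (m i)) ^ digit m j i" for i t
  have prod_split: "prod g {..<K} = prod g {..<k} * prod g {k..<K}" for g :: "nat \<Rightarrow> complex"
    using prod.atLeastLessThan_concat[of 0 k K g] kK by (simp add: atLeast0LessThan)
  have ind: "(\<Prod>i<k. of_bool (y i = x i)) = (indicator (Icyl m k x) y :: complex)"
    if "y \<in> space (Gm m)" for y
    using that by (auto simp: Icyl_def indicator_def prod_zero_iff)
  have "(\<integral>y. indicator (Icyl m k x) y *\<^sub>R vilenkin m j y \<partial>Gm m) = (\<integral>y. (\<Prod>i<K. h i (y i)) \<partial>Gm m)"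
  proof (rule Bochner_Integration.integral_cong[OF refl])
    fix y assume y: "y \<in> space (Gm m)"
    have "(\<Prod>i<K. h i (y i)) = (\<Prod>i<K. if i < k then of_bool (y i = x i) else 1) * vilenkin m j y"
      unfolding vilenkin_eq_prod[OF jK] h_def prod.distrib rademacher_def ..
    also have "(\<Prod>i<K. if i < k then of_bool (y i = x i) else 1) = (\<Prod>i<k. of_bool (y i = x i) :: complex)"
      unfolding prod_split by simp
    finally show "indicator (Icyl m k x) y *\<^sub>R vilenkin m j y = (\<Prod>i<K. h i (y i))"
      using ind[OF y] by (simp add: scaleR_conv_of_real indicator_def)
  qed
  also have "\<dots> = (\<Prod>i<K. (\<Sum>t<m i. h i t) / of_nat (m i))"
    by (rule integral_prod_coord)
  also have "\<dots> = (\<Prod>i<k. rademacher m i x ^ digit m j i / of_nat (m i)) *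
      (\<Prod>i=k..<K. of_bool (digit m j i = 0))"
    unfolding prod_split
  proof (intro arg_cong2[where f="(*)"] prod.cong refl)
    fix i assume "i \<in> {..<k}"
    moreover have "x i < m i" using assms by (simp add: space_Gm)
    ultimately show "(\<Sum>t<m i. h i t) / of_nat (m i) = rademacher m i x ^ digit m j i / of_nat (m i)"
      by (simp add: h_def rademacher_def of_bool_def if_distrib[of "\<lambda>u. u * _"] sum.delta cong: if_cong)
  next
    fix i assume "i \<in> {k..<K}"
    then show "(\<Sum>t<m i. h i t) / of_nat (m i) = of_bool (digit m j i = 0)"
      using sum_rademacher_powers[of "digit m j i" i] by (simp add: h_def digit_def)
  qed
  also have "(\<Prod>i<k. rademacher m i x ^ digit m j i / of_nat (m i)) =
      (\<Prod>i<k. rademacher m i x ^ digit m j i) / of_nat (M k)"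
    by (simp add: prod_dividef Mseq_def)
  also have "(\<Prod>i=k..<K. of_bool (digit m j i = 0)) = (of_bool (j < M k) :: complex)"
    using digit_eq_0[of j k] digits_eq_0_imp_less[OF jK, of k] by (cases "j < M k") (simp, force)
  finally show ?thesis
    using M_pos[of k] by (auto simp: cond_exp_k_def vilenkin_eq_prod)
qed

lemma vilenkin_zero [simp]: "vilenkin m 0 x = 1"
  by (simp add: vilenkin_def)

lemma vilenkin_at_zero [simp]: "vilenkin m n (\<lambda>_. 0) = 1"
  by (simp add: vilenkin_def rademacher_def)

section \<open>Cylinders at zero and Dirichlet kernels\<close>

abbreviation "I k \<equiv> Icyl m k (\<lambda>_. 0)"

lemma mem_I: "x \<in> I k \<longleftrightarrow> x \<in> space (Gm m) \<and> (\<forall>j<k. x j = 0)"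
  by (simp add: Icyl_def)

lemma integral_I_vilenkin:
  "(\<integral>y. indicator (I k) y *\<^sub>R vilenkin m j y \<partial>Gm m) = (if j < M k then 1 / of_nat (M k) else 0)"
  using cond_exp_vilenkin[OF zero_in_space, of k j] M_pos[of k]
  by (auto simp: cond_exp_k_def field_simps split: if_splits)

lemma measure_I: "measure (Gm m) (I k) = 1 / real (M k)"
  using integral_I_vilenkin[of k 0]
  by (simp add: scaleR_conv_of_real) (metis of_real_1 of_real_divide of_real_eq_iff of_real_of_nat_eq)


lemma emeasure_I: "emeasure (Gm m) (I k) = ennreal (1 / real (M k))"
  by (simp add: Gm.emeasure_eq_measure measure_I)

text \<open>On I_s the first s Rademacher functions equal 1, and adding v < M_s to a multiple of M_s
  leaves the digits from position s on unchanged. This makes the characters of a whole block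
  coincide there.\<close>

lemma vilenkin_block:
  assumes "x \<in> I s" "M s dvd w" "v < M s"
  shows "vilenkin m (w + v) x = vilenkin m w x"
proof -
  define K where "K = s + w + v"
  have K: "w + v < M K" "w < M K" "s \<le> K"
    using less_M[of K] by (auto simp: K_def)
  have "rademacher m k x ^ digit m (w + v) k = rademacher m k x ^ digit m w k" for k
  proof (cases "k < s")
    case True
    then show ?thesis using assms(1) by (simp add: mem_I rademacher_def)
  next
    case False
    then have "M s dvd M k" by (simp add: M_dvd)
    then obtain c d where "M k = M s * c" "w = M s * d" using assms(2) by (auto elim!: dvdE)
    then have "(w + v) div M k = w div M k"
      using assms(3) by (simp add: div_mult2_eq)
    then show ?thesis by (simp add: digit_def)
  qed
  then show ?thesis using K by (simp add: vilenkin_eq_prod[of _ K])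
qed

text \<open>Adding a M_k to b < M_k changes only digit k, from 0 to a. This yields the recursion for
  the Dirichlet kernels.\<close>

lemma vilenkin_mult_add:
  assumes "b < M k" "a < m k"
  shows "vilenkin m (a * M k + b) x = rademacher m k x ^ a * vilenkin m b x"
proof -
  have lt: "a * M k + b < M (Suc k)"
  proof -
    have "a * M k + b < Suc a * M k" using assms(1) by simp
    also have "\<dots> \<le> M (Suc k)" unfolding M_Suc using assms(2) by (intro mult_right_mono) auto
    finally show ?thesis .
  qed
  have "digit m (a * M k + b) i = digit m b i" if "i < k" for i
  proof -
    have "M (Suc i) dvd M k" using that by (simp add: M_dvd)
    then obtain c where c: "M k = M i * (m i * c)" by (metis M_Suc dvdE mult.assoc mult.commute)
    have "(a * M k + b) div M i = b div M i + m i * (c * a)" 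
      using div_mult_self1[of "M i" b "m i * (c * a)"] M_pos[of i] by (simp add: c algebra_simps)
    then show ?thesis by (simp add: digit_def)
  qed
  moreover have "digit m (a * M k + b) k = a"
    using assms by (simp add: digit_def)
  ultimately show ?thesis
    unfolding vilenkin_eq_prod[OF lt] vilenkin_eq_prod[OF assms(1)] by (simp add: mult.commute)
qed

text \<open>Writing indices as a M_k + b multiplies the kernel of order M_k by the sum of r_k^a over
  a < m_k, which is m_k or 0 according to whether x_k = 0.\<close>

lemma sum_vilenkin:
  assumes "x \<in> space (Gm m)"
  shows "(\<Sum>j<M k. vilenkin m j x) = of_nat (M k) * indicator (I k) x"
proof (induction k)
  case 0
  then show ?case using assms by (simp add: mem_I indicator_def)
next
  case (Suc k)
  have xk: "x k < m k" using assms by (simp add: space_Gm)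
  have "(\<Sum>j<M (Suc k). vilenkin m j x) = (\<Sum>a<m k. \<Sum>b<M k. vilenkin m (a * M k + b) x)"
    unfolding M_Suc by (rule sum_blocks)
  also have "\<dots> = (\<Sum>a<m k. rademacher m k x ^ a) * (of_nat (M k) * indicator (I k) x)"
    by (simp add: vilenkin_mult_add sum_product Suc flip: sum_distrib_left sum_distrib_right)
  \<comment> \<open>r_k(x)^a is symmetric in a and x_k, so the coordinate can take the role of the
    exponent in \<open>sum_rademacher_powers\<close>.\<close>
  also have "(\<Sum>a<m k. rademacher m k x ^ a) = (\<Sum>t<m k. cis (2 * pi * real t / real (m k)) ^ x k)"
    by (intro sum.cong) (auto simp: rademacher_def Complex.DeMoivre mult_ac)
  also have "\<dots> = of_nat (m k) * of_bool (x k = 0)"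
    by (simp add: sum_rademacher_powers[OF xk])
  also have "\<dots> * (of_nat (M k) * indicator (I k) x) = of_nat (M (Suc k)) * indicator (I (Suc k)) x"
    by (auto simp: M_Suc mem_I indicator_def less_Suc_eq)
  finally show ?case .
qed

section \<open>Martingales constant on shells\<close>

definition shell_mart :: "(nat \<Rightarrow> real) \<Rightarrow> nat \<Rightarrow> (nat \<Rightarrow> nat) \<Rightarrow> complex" where
  "shell_mart l n x = (\<Sum>k<n. of_real (l k * real (M k)) *
     (of_nat (M (Suc k)) * indicator (I (Suc k)) x - of_nat (M k) * indicator (I k) x))"

text \<open>At most one summand is nonzero, since the blocks [M_k, M_{k+1}) are disjoint, and the
  range k < j loses nothing because k < M_k. Index 0 lies in no block and gets coefficient
  0.\<close>

definition shell_coeff :: "(nat \<Rightarrow> real) \<Rightarrow> nat \<Rightarrow> complex" where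
  "shell_coeff l j = (\<Sum>k<j. if M k \<le> j \<and> j < M (Suc k) then of_real (l k * real (M k)) else 0)"

lemma shell_coeff_eq:
  assumes "M k \<le> j" "j < M (Suc k)"
  shows "shell_coeff l j = of_real (l k * real (M k))"
proof -
  have "(M i \<le> j \<and> j < M (Suc i)) \<longleftrightarrow> i = k" for i
  proof
    assume i: "M i \<le> j \<and> j < M (Suc i)"
    show "i = k"
    proof (rule ccontr)
      assume "i \<noteq> k"
      then have "Suc i \<le> k \<or> Suc k \<le> i" by auto
      then show False using M_mono[of "Suc i" k] M_mono[of "Suc k" i] i assms by auto
    qed
  qed (use assms in auto)
  moreover have "k < j" using less_M[of k] assms by simp
  ultimately show ?thesis by (simp add: shell_coeff_def)
qed

lemma integrable_bounded:
  fixes g :: "_ \<Rightarrow> complex"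
  assumes [measurable]: "g \<in> borel_measurable (Gm m)" and "\<And>x. norm (g x) \<le> B"
  shows "integrable (Gm m) g"
  by (rule Gm.integrable_const_bound[of _ B]) (use assms in auto)

lemma integrable_I_vilenkin: "integrable (Gm m) (\<lambda>y. indicator (Icyl m k x) y *\<^sub>R vilenkin m j y)"
  by (rule integrable_bounded[of _ 1]) (auto simp: indicator_def)

text \<open>Blocks with k \<ge> j start beyond j because k < M_k, so the integrals are constant from
  n = j on and the limit is attained.\<close>

lemma fourier_coeff_shell_mart: "fourier_coeff m (shell_mart l) j = shell_coeff l j"
proof -
  have ind: "(\<integral>x. indicator (I k) x * cnj (vilenkin m j x) \<partial>Gm m) = (if j < M k then 1 / of_nat (M k) else 0)" for k
  proof -
    have "(\<integral>x. indicator (I k) x * cnj (vilenkin m j x) \<partial>Gm m) =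
        (\<integral>x. cnj (indicator (I k) x *\<^sub>R vilenkin m j x) \<partial>Gm m)"
      by (intro Bochner_Integration.integral_cong) (auto simp: indicator_def)
    also have "\<dots> = cnj (if j < M k then 1 / of_nat (M k) else 0)"
      by (simp add: integral_I_vilenkin del: complex_cnj_scaleR)
    finally show ?thesis by simp
  qed
  have int: "integrable (Gm m) (\<lambda>x. indicator (I k) x * cnj (vilenkin m j x))" for k
  proof (rule integrable_bounded[of _ 1])
    show "(\<lambda>x. indicator (I k) x * cnj (vilenkin m j x)) \<in> borel_measurable (Gm m)"
      by (intro borel_measurable_times borel_measurable_indicator measurable_Icyl
          measurable_compose[OF measurable_vilenkin borel_measurable_continuous_onI] continuous_intros)
  qed (auto simp: indicator_def)
  have val: "(\<integral>x. shell_mart l n x * cnj (vilenkin m j x) \<partial>Gm m) =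
      (\<Sum>k<n. if M k \<le> j \<and> j < M (Suc k) then of_real (l k * real (M k)) else 0)" for n
  proof -
    have "(\<integral>x. shell_mart l n x * cnj (vilenkin m j x) \<partial>Gm m) =
        (\<integral>x. (\<Sum>k<n. of_real (l k * real (M k)) *
          (of_nat (M (Suc k)) * (indicator (I (Suc k)) x * cnj (vilenkin m j x))
           - of_nat (M k) * (indicator (I k) x * cnj (vilenkin m j x)))) \<partial>Gm m)"
      by (intro Bochner_Integration.integral_cong refl)
        (simp add: shell_mart_def sum_distrib_right left_diff_distrib mult.assoc)
    also have "\<dots> = (\<Sum>k<n. of_real (l k * real (M k)) *
          (of_nat (M (Suc k)) * (if j < M (Suc k) then 1 / of_nat (M (Suc k)) else 0)
           - of_nat (M k) * (if j < M k then 1 / of_nat (M k) else 0)))"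
      by (simp add: int ind)
    also have "\<dots> = (\<Sum>k<n. if M k \<le> j \<and> j < M (Suc k) then of_real (l k * real (M k)) else 0)"
    proof (intro sum.cong refl)
      fix k
      show "of_real (l k * real (M k)) *
          (of_nat (M (Suc k)) * (if j < M (Suc k) then 1 / of_nat (M (Suc k)) else 0)
           - of_nat (M k) * (if j < M k then 1 / of_nat (M k) else 0)) =
         (if M k \<le> j \<and> j < M (Suc k) then complex_of_real (l k * real (M k)) else 0)"
        using M_mono[of k "Suc k"] by auto
    qed
    finally show ?thesis .
  qed
  have "(\<lambda>n. \<integral>x. shell_mart l n x * cnj (vilenkin m j x) \<partial>Gm m) \<longlonglongrightarrow> shell_coeff l j"
  proof (rule tendsto_eventually, rule eventually_sequentiallyI)
    fix n assume "j \<le> n"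
    then show "(\<integral>x. shell_mart l n x * cnj (vilenkin m j x) \<partial>Gm m) = shell_coeff l j"
      unfolding val shell_coeff_def
    proof (intro sum.mono_neutral_right ballI)
      fix k assume "k \<in> {..<n} - {..<j}"
      then have "j < M k" using less_M[of k] by simp
      then show "(if M k \<le> j \<and> j < M (Suc k) then complex_of_real (l k * real (M k)) else 0) = 0"
        by simp
    qed auto
  qed
  then show ?thesis unfolding fourier_coeff_def by (rule limI)
qed

text \<open>The n-th martingale term is S_{M_n} of its own Fourier series, a form to which
  conditional expectations apply termwise.\<close>

lemma shell_mart_eq_sum:
  assumes "x \<in> space (Gm m)"
  shows "shell_mart l n x = (\<Sum>j<M n. shell_coeff l j * vilenkin m j x)"
proof (induction n)
  case 0
  then show ?case by (simp add: shell_mart_def shell_coeff_def)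
next
  case (Suc n)
  have split: "(\<Sum>j<M (Suc n). g j) = (\<Sum>j<M n. g j) + (\<Sum>j=M n..<M (Suc n). g j)" for g :: "nat \<Rightarrow> complex"
    using sum.atLeastLessThan_concat[of 0 "M n" "M (Suc n)" g] M_mono[of n "Suc n"]
    by (simp add: atLeast0LessThan)
  have "(\<Sum>j=M n..<M (Suc n). shell_coeff l j * vilenkin m j x) =
      of_real (l n * real (M n)) * (\<Sum>j=M n..<M (Suc n). vilenkin m j x)"
    unfolding sum_distrib_left by (intro sum.cong refl, subst shell_coeff_eq) auto
  also have "(\<Sum>j=M n..<M (Suc n). vilenkin m j x) =
     of_nat (M (Suc n)) * indicator (I (Suc n)) x - of_nat (M n) * indicator (I n) x"
    using split[of "\<lambda>j. vilenkin m j x"] by (simp add: sum_vilenkin[OF assms] algebra_simps)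
  finally show ?case
    using Suc by (simp add: shell_mart_def split)
qed

lemma partial_sum_shell_mart:
  "partial_sum m (shell_mart l) n x = (\<Sum>j<n. shell_coeff l j * vilenkin m j x)"
  by (simp add: partial_sum_def fourier_coeff_shell_mart)

text \<open>Conditioning at level k keeps the characters below M_k and annihilates the others, so
  S_{M_N} is cut off at the smaller of M_k and M_N.\<close>

lemma cond_exp_partial_sum:
  assumes "x \<in> space (Gm m)"
  shows "cond_exp_k m k (partial_sum m (shell_mart l) (M N)) x = shell_mart l (min k N) x"
proof -
  have "cond_exp_k m k (partial_sum m (shell_mart l) (M N)) x =
      of_nat (M k) * (\<integral>y. (\<Sum>j<M N. shell_coeff l j * (indicator (Icyl m k x) y *\<^sub>R vilenkin m j y)) \<partial>Gm m)"
    unfolding cond_exp_k_def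
    by (intro arg_cong2[where f="(*)"] Bochner_Integration.integral_cong refl)
      (simp add: partial_sum_shell_mart scaleR_sum_right)
  also have "\<dots> = (\<Sum>j<M N. shell_coeff l j * cond_exp_k m k (vilenkin m j) x)"
    by (subst Bochner_Integration.integral_sum)
      (simp_all only: integrable_I_vilenkin integrable_mult_right integral_mult_right_zero
        cond_exp_k_def sum_distrib_left mult.left_commute)
  also have "\<dots> = (\<Sum>j<M N. if j < M k then shell_coeff l j * vilenkin m j x else 0)"
    by (simp add: cond_exp_vilenkin[OF assms] if_distrib cong: if_cong)
  also have "\<dots> = (\<Sum>j<M (min k N). shell_coeff l j * vilenkin m j x)"
    using M_mono[of k N] M_mono[of N k]
    by (intro sum.mono_neutral_cong_right) (auto simp: min_def split: if_splits)
  also have "\<dots> = shell_mart l (min k N) x"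
    by (simp add: shell_mart_eq_sum[OF assms])
  finally show ?thesis .
qed

lemma is_martingale_shell_mart: "is_martingale m (shell_mart l)"
  unfolding is_martingale_def
proof (intro conjI allI impI)
  fix n x y assume xy: "x \<in> space (Gm m)" "y \<in> space (Gm m)" "\<forall>j<n. x j = y j"
  have "indicator (I k) x = (indicator (I k) y :: complex)" if "k \<le> n" for k
    using xy that by (auto simp: mem_I indicator_def)
  then show "shell_mart l n x = shell_mart l n y"
    by (auto simp: shell_mart_def intro!: sum.cong)
next
  fix n x assume x: "x \<in> space (Gm m)"
  have upd: "x(n := j) \<in> space (Gm m)" if "j < m n" for j
    using that x by (auto simp: space_Gm)
  have ind: "indicator (I k) (x(n := j)) = (indicator (I k) x :: complex)" if "j < m n" "k \<le> n" for j k
    using that x upd[of j] by (auto simp: mem_I indicator_def)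
  \<comment> \<open>Of the m_n subcylinders of I_n only the one with j = 0 is I_{n+1}. Its weight
    M_{n+1} = m_n M_n balances the m_n copies of M_n, so the increment averages to 0.\<close>
  have ind': "indicator (I (Suc n)) (x(n := j)) = (of_bool (j = 0) * indicator (I n) x :: complex)" if "j < m n" for j
    using that x upd[of j] by (auto simp: mem_I indicator_def less_Suc_eq)
  have "(\<Sum>j<m n. shell_mart l (Suc n) (x(n := j))) =
      (\<Sum>j<m n. shell_mart l n x + of_real (l n * real (M n)) *
         (of_nat (M (Suc n)) * (of_bool (j = 0) * indicator (I n) x) - of_nat (M n) * indicator (I n) x))"
    by (intro sum.cong refl) (auto simp: shell_mart_def ind ind')
  also have "\<dots> = of_nat (m n) * shell_mart l n x + of_real (l n * real (M n)) *
         (of_nat (M (Suc n)) * ((\<Sum>j<m n. of_bool (j = 0)) * indicator (I n) x) - of_nat (m n) * (of_nat (M n) * indicator (I n) x))"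
    by (simp add: sum.distrib sum_subtractf flip: sum_distrib_left sum_distrib_right)
  also have "\<dots> = of_nat (m n) * shell_mart l n x"
    by (simp add: M_Suc of_bool_def)
  finally show "shell_mart l n x = (\<Sum>j<m n. shell_mart l (Suc n) (x(n := j))) / of_nat (m n)"
    by simp
qed

lemma measurable_shell_mart [measurable]: "shell_mart l n \<in> borel_measurable (Gm m)"
  unfolding shell_mart_def[abs_def] by measurable

section \<open>Hardy norm estimates\<close>

text \<open>Since p \<le> 1, the p-th power of the dominating sum is at most the sum of b_k^p over
  those k \<ge> N with x in I_k, uniformly in n. Integrating with mu(I_k) = 1/M_k gives a series
  majorized by \<open>a\<close>.\<close>

lemma Hp_norm_le:
  fixes b a :: "nat \<Rightarrow> real"
  assumes p: "0 < p" "p \<le> 1" and b: "\<And>k. 0 \<le> b k"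
    and G: "\<And>n x. x \<in> space (Gm m) \<Longrightarrow> norm (G n x) \<le> (\<Sum>k=N..<n. b k * indicator (I k) x)"
    and a: "\<And>k. b (k + N) powr p / real (M (k + N)) \<le> a k" "a sums A"
  shows "Hp_norm m p G \<le> ennreal (A powr (1 / p))"
proof -
  have a0: "0 \<le> a k" for k by (rule order_trans[OF _ a(1)]) auto
  define R where "R x = (\<Sum>k. ennreal (b (k + N) powr p) * indicator (I (k + N)) x)" for x :: "nat \<Rightarrow> nat"
  have pointwise: "enn_powr (maximal_fn G x) p \<le> R x" if x: "x \<in> space (Gm m)" for x
    unfolding maximal_fn_def
  proof (rule enn_powr_SUP_le)
    fix n
    have "norm (G n x) powr p \<le> (\<Sum>k=N..<n. b k * indicator (I k) x) powr p"
      using G[OF x] p by (intro powr_mono2) auto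
    also have "\<dots> \<le> (\<Sum>k=N..<n. (b k * indicator (I k) x) powr p)"
      using p b by (intro powr_sum_le) auto
    also have "\<dots> = (\<Sum>k=N..<n. b k powr p * indicator (I k) x)"
      using p by (intro sum.cong) (auto simp: indicator_def)
    finally have "ennreal (norm (G n x) powr p) \<le> ennreal (\<Sum>k=N..<n. b k powr p * indicator (I k) x)"
      by (rule ennreal_leI)
    also have "\<dots> = (\<Sum>k=N..<n. ennreal (b k powr p) * indicator (I k) x)"
      by (subst sum_ennreal[symmetric]) (auto simp: ennreal_mult' ennreal_indicator)
    also have "\<dots> = (\<Sum>k<n - N. ennreal (b (k + N) powr p) * indicator (I (k + N)) x)"
      by (rule sum.reindex_bij_witness[of _ "\<lambda>k. k + N" "\<lambda>k. k - N"]) auto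
    also have "\<dots> \<le> R x"
      unfolding R_def by (rule sum_le_suminf) auto
    finally show "ennreal (norm (G n x) powr p) \<le> R x" .
  qed (use p in auto)
  have "(\<integral>\<^sup>+x. enn_powr (maximal_fn G x) p \<partial>Gm m) \<le> (\<integral>\<^sup>+x. R x \<partial>Gm m)"
    by (intro nn_integral_mono pointwise)
  also have "\<dots> = (\<Sum>k. \<integral>\<^sup>+x. ennreal (b (k + N) powr p) * indicator (I (k + N)) x \<partial>Gm m)"
    unfolding R_def by (rule nn_integral_suminf) measurable
  also have "\<dots> = (\<Sum>k. ennreal (b (k + N) powr p / real (M (k + N))))"
    by (simp add: nn_integral_cmult_indicator emeasure_I flip: ennreal_mult)
  also have "\<dots> \<le> (\<Sum>k. ennreal (a k))"
    by (intro suminf_le ennreal_leI a) auto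
  also have "\<dots> = ennreal A"
    using a0 a(2) by (simp add: suminf_ennreal2 sums_iff)
  finally show ?thesis
    unfolding Hp_norm_def
    using p sums_le[OF a0 sums_zero a(2)] by (intro enn_powr_le) auto
qed

text \<open>The bracket in the k-th increment is M_{k+1} - M_k on I_{k+1}, has modulus M_k on the
  rest of I_k and vanishes elsewhere. In all cases it is at most M_{k+1} \<le> B M_k.\<close>

lemma norm_shell_mart_diff_le:
  fixes n :: nat
  assumes x: "x \<in> space (Gm m)" and l: "\<And>k. 0 \<le> l k" and B: "\<And>k. real (m k) \<le> B"
  shows "norm (shell_mart l n x - shell_mart l (min n N) x) \<le> 
    (\<Sum>k=N..<n. (l k * B * real (M k) ^ 2) * indicator (I k) x)"
proof -
  define d where "d k = complex_of_real (l k * real (M k)) *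
     (of_nat (M (Suc k)) * indicator (I (Suc k)) x - of_nat (M k) * indicator (I k) x)" for k
  have bound: "norm (d k) \<le> (l k * B * real (M k) ^ 2) * indicator (I k) x" for k
  proof -
    have "norm (complex_of_nat (M (Suc k)) * indicator (I (Suc k)) x - of_nat (M k) * indicator (I k) x)
        \<le> real (M (Suc k)) * indicator (I k) x"
    proof (cases "x \<in> I (Suc k)")
      case True
      then have "x \<in> I k" by (simp add: mem_I)
      moreover have "norm (complex_of_nat (M (Suc k)) - of_nat (M k)) = real (M (Suc k)) - real (M k)"
        using M_mono[of k "Suc k"] by (metis norm_of_nat of_nat_diff Suc_n_not_le_n nle_le)
      ultimately show ?thesis using True by simp
    next
      case False
      then show ?thesis using M_mono[of k "Suc k"] by (auto simp: indicator_def)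
    qed
    also have "real (M (Suc k)) * indicator (I k) x \<le> (B * real (M k)) * indicator (I k) x"
      using B[of k] by (intro mult_right_mono) (auto simp: M_Suc)
    finally have "norm (d k) \<le> (l k * real (M k)) * ((B * real (M k)) * indicator (I k) x)"
      using l[of k] unfolding d_def norm_mult by (intro mult_mono) (auto simp: norm_mult)
    then show ?thesis by (simp add: power2_eq_square mult_ac)
  qed
  have "shell_mart l n x = shell_mart l (min n N) x + (\<Sum>k=N..<n. d k)"
  proof (cases "n \<le> N")
    case False
    then show ?thesis
      using sum.atLeastLessThan_concat[of 0 N n d]
      by (simp add: shell_mart_def d_def atLeast0LessThan)
  qed (simp add: min_def)
  then have "norm (shell_mart l n x - shell_mart l (min n N) x) = norm (\<Sum>k=N..<n. d k)"
    by simp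
  also have "\<dots> \<le> (\<Sum>k=N..<n. (l k * B * real (M k) ^ 2) * indicator (I k) x)"
    by (intro sum_norm_le bound)
  finally show ?thesis .
qed

text \<open>The n-th term of f - S_{M_N} f is the difference of the martingale terms n and min n N,
  so only increments from N on enter.\<close>

lemma modulus_shell_mart_le:
  assumes p: "0 < p" "p \<le> 1" and l: "\<And>k. 0 \<le> l k" and B: "\<And>k. real (m k) \<le> B"
    and a: "\<And>k. (l (k + N) * B * real (M (k + N)) ^ 2) powr p / real (M (k + N)) \<le> a k" "a sums A"
  shows "modulus_Hp m p N (shell_mart l) \<le> ennreal (A powr (1 / p))"
  unfolding modulus_Hp_def
proof (rule Hp_norm_le[OF p _ _ a])
  show "0 \<le> l k * B * real (M k) ^ 2" for k
    using l[of k] B[of k] by (intro mult_nonneg_nonneg) (auto intro: order_trans[of _ "real (m k)"])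
  fix n x assume "x \<in> space (Gm m)"
  then show "norm (shell_mart l n x - cond_exp_k m n (partial_sum m (shell_mart l) (M N)) x) \<le>
    (\<Sum>k=N..<n. l k * B * real (M k) ^ 2 * indicator (I k) x)"
    using norm_shell_mart_diff_le[OF _ l B] by (simp add: cond_exp_partial_sum)
qed

lemma Hp_norm_shell_mart_finite:
  assumes p: "0 < p" "p \<le> 1" and l: "\<And>k. 0 \<le> l k" and B: "\<And>k. real (m k) \<le> B"
    and a: "\<And>k. (l k * B * real (M k) ^ 2) powr p / real (M k) \<le> a k" "summable a"
  shows "Hp_norm m p (shell_mart l) < \<infinity>"
proof -
  \<comment> \<open>With N = 0 the subtracted term \<open>shell_mart l 0\<close> is an empty sum, so
    the same bound covers f itself.\<close>
  have "Hp_norm m p (shell_mart l) \<le> ennreal (suminf a powr (1 / p))"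
  proof (rule Hp_norm_le[OF p, where N=0 and a=a and b="\<lambda>k. l k * B * real (M k) ^ 2"])
    show "0 \<le> l k * B * real (M k) ^ 2" for k
      using l[of k] B[of k] by (intro mult_nonneg_nonneg) (auto intro: order_trans[of _ "real (m k)"])
    show "(l (k + 0) * B * real (M (k + 0)) ^ 2) powr p / real (M (k + 0)) \<le> a k" for k
      using a(1) by simp
    show "a sums suminf a" by (rule summable_sums) fact
    fix n x assume "x \<in> space (Gm m)"
    then show "norm (shell_mart l n x) \<le> (\<Sum>k=0..<n. l k * B * real (M k) ^ 2 * indicator (I k) x)"
      using norm_shell_mart_diff_le[OF _ l B, where x=x and n=n and N=0] by (simp add: shell_mart_def)
  qed
  then show ?thesis by (simp add: order.strict_trans1)
qed

section \<open>Almost everywhere convergence\<close>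

text \<open>The cylinders I_k shrink to the point 0 and have measure at most 2^(-k), so that point
  is null.\<close>

lemma AE_nonzero_coord: "AE x in Gm m. \<exists>j. x j \<noteq> 0"
proof -
  have "emeasure (Gm m) (\<Inter>k. I k) = 0"
  proof -
    have "measure (Gm m) (\<Inter>k. I k) \<le> (1/2) ^ k" for k
    proof -
      have "measure (Gm m) (\<Inter>k. I k) \<le> measure (Gm m) (I k)"
        by (rule Gm.finite_measure_mono) auto
      also have "\<dots> \<le> 1 / 2 ^ k"
        using two_power_le_M[of k] unfolding measure_I
        by (intro divide_left_mono) (auto simp: numeral_power_le_of_nat_cancel_iff)
      finally show ?thesis by (simp add: power_divide)
    qed
    then have "measure (Gm m) (\<Inter>k. I k) \<le> 0"
      by (intro LIMSEQ_le_const[OF LIMSEQ_realpow_zero[of "1/2"]]) auto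
    then show ?thesis by (simp add: Gm.emeasure_eq_measure measure_le_0_iff)
  qed
  then have "(\<Inter>k. I k) \<in> null_sets (Gm m)" by (intro null_setsI) auto
  then show ?thesis
    by (rule AE_I') (auto simp: mem_I)
qed

text \<open>If x_j \<noteq> 0, then x lies outside I_k for all k > j, and the sequence is constant
  from index j+1 on.\<close>

lemma AE_shell_mart_converges:
  "AE x in Gm m. (\<lambda>n. shell_mart l n x) \<longlonglongrightarrow> lim (\<lambda>n. shell_mart l n x)"
  using AE_nonzero_coord
proof (rule AE_mp, intro AE_I2 impI)
  fix x :: "nat \<Rightarrow> nat" assume "\<exists>j. x j \<noteq> 0"
  then obtain j where "x j \<noteq> 0" by blast
  then have out: "x \<notin> I k" if "Suc j \<le> k" for k using that by (auto simp: mem_I intro!: exI[of _ j])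
  have "shell_mart l n x = shell_mart l (Suc j) x" if "Suc j \<le> n" for n
    unfolding shell_mart_def using that out by (intro sum.mono_neutral_right) auto
  then have "(\<lambda>n. shell_mart l n x) \<longlonglongrightarrow> shell_mart l (Suc j) x"
    by (intro tendsto_eventually eventually_sequentiallyI)
  then show "(\<lambda>n. shell_mart l n x) \<longlonglongrightarrow> lim (\<lambda>n. shell_mart l n x)"
    by (simp add: limI)
qed

lemma measurable_fejer_mean [measurable]: "fejer_mean m F n \<in> borel_measurable (Gm m)"
  unfolding fejer_mean_def[abs_def] partial_sum_def by measurable

section \<open>Divergence of the Fejer means\<close>

text \<open>The constant c stands for f(x) and cancels. The remaining indices run from n+1 to
  n+2h-1, hence inside [w, w + M_s), where \<open>vilenkin_block\<close> gives one common character
  and all coefficients are l_k M_k.\<close>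

lemma norm_second_difference_fejer:
  fixes c :: complex
  assumes x: "x \<in> I s" and w: "M s dvd w" "M k \<le> w" "w + M s \<le> M (Suc k)"
    and n: "w \<le> n + 1" "n + 2 * h \<le> w + M s" and l: "0 \<le> l k"
  defines "E \<equiv> \<lambda>n. of_nat n * (fejer_mean m (shell_mart l) n x - c)"
  shows "norm (E (n + 2 * h) - 2 * E (n + h) + E n) = l k * real (M k) * real h ^ 2"
proof -
  define a where "a j = shell_coeff l j * vilenkin m j x" for j
  have E: "E = (\<lambda>n. (\<Sum>k=1..n. \<Sum>j<k. a j) - of_nat n * c)"
    by (auto simp: E_def a_def fejer_mean_def partial_sum_shell_mart fun_eq_iff right_diff_distrib)
  have val: "a (n + i + j + 1) = of_real (l k * real (M k)) * vilenkin m w x" if "i < h" "j < h" for i j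
  proof -
    define v where "v = n + i + j + 1 - w"
    have v: "n + i + j + 1 = w + v" "v < M s"
      using that n by (auto simp: v_def)
    have "a (w + v) = of_real (l k * real (M k)) * vilenkin m w x"
      unfolding a_def vilenkin_block[OF x w(1) v(2)]
      using w v(2) by (subst shell_coeff_eq[of k]) auto
    then show ?thesis by (simp only: v)
  qed
  have "E (n + 2 * h) - 2 * E (n + h) + E n = (\<Sum>i<h. \<Sum>j<h. a (n + i + j + 1))"
    unfolding E by (rule second_difference_sums)
  also have "\<dots> = (\<Sum>i<h. \<Sum>j<h. of_real (l k * real (M k)) * vilenkin m w x)"
    by (intro sum.cong refl val) auto
  also have "\<dots> = of_nat h * (of_nat h * (of_real (l k * real (M k)) * vilenkin m w x))"
    by simp
  finally show ?thesis
    using l by (simp add: norm_mult power2_eq_square)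
qed

text \<open>For three consecutive indices the sets where the error exceeds 1/8 cover the group, so
  the three weak quasinorms add up to at least (1/8)^p.\<close>

lemma weak_fejer_not_tendsto_0:
  assumes f [measurable]: "f \<in> borel_measurable (Gm m)"
  defines "F \<equiv> shell_mart (\<lambda>_. 1)"
  shows "\<not> (\<lambda>n. weak_Lp_norm m p (\<lambda>x. fejer_mean m F n x - f x)) \<longlonglongrightarrow> 0"
proof
  define g where "g n x = norm (fejer_mean m F n x - f x)" for n x
  define W where "W n = weak_Lp_norm m p (\<lambda>x. fejer_mean m F n x - f x)" for n
  \<comment> \<open>Three times this value is still below (1/8)^p.\<close>
  define \<epsilon> where "\<epsilon> = (1/8) powr p / (4::real)"
  have \<epsilon>: "0 < \<epsilon>" by (simp add: \<epsilon>_def)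
  assume "(\<lambda>n. weak_Lp_norm m p (\<lambda>x. fejer_mean m F n x - f x)) \<longlonglongrightarrow> 0"
  then have "eventually (\<lambda>n. W n < ennreal \<epsilon>) sequentially"
    unfolding W_def using \<epsilon> by (intro order_tendstoD) (auto simp: ennreal_less_zero_iff)
  then obtain n0 where n0: "\<And>n. n0 \<le> n \<Longrightarrow> W n < ennreal \<epsilon>"
    by (auto simp: eventually_sequentially)
  \<comment> \<open>The only index strictly between n and n+2 is then M_{n0+1}, the first of its
    block.\<close>
  define n where "n = M (Suc n0) - 1"
  have n_M: "M (Suc n0) = n + 1" by (simp add: n_def)
  have n_ge: "n0 \<le> n" using less_M[of "Suc n0"] by (simp add: n_def)
  define A where "A i = {x \<in> space (Gm m). 1/8 < g i x}" for i
  have A_sets [measurable]: "A i \<in> sets (Gm m)" for i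
    unfolding A_def g_def by measurable
  have A_le: "ennreal ((1/8) powr p) * emeasure (Gm m) (A i) \<le> W i" for i
    unfolding W_def weak_Lp_norm_def A_def g_def by (rule SUP_upper2[of "1/8"]) auto
  have cover: "space (Gm m) \<subseteq> A (n + 2) \<union> A (n + 1) \<union> A n"
  proof
    fix x assume x: "x \<in> space (Gm m)"
    define E where "E n = of_nat n * (fejer_mean m F n x - f x)" for n
    have E: "norm (E i) = real i * g i x" for i
      by (simp add: E_def g_def norm_mult)
    \<comment> \<open>Room for a block of length M_0 = 1. With s = 0 the cylinder is the whole
      space, so the estimate holds at every point.\<close>
    have "n + 1 + M 0 \<le> M (Suc (Suc n0))"
      using mult_le_mono1[OF m_ge2[of "Suc n0"], of "M (Suc n0)"] by (simp add: M_Suc[of "Suc n0"] n_M)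
    then have "real (n + 1) = norm (E (n + 2 * 1) - 2 * E (n + 1) + E n)"
      unfolding E_def F_def
      by (subst norm_second_difference_fejer[of x 0 "n + 1" "Suc n0"]) (use x n_M in \<open>auto simp: mem_I\<close>)
    also have "\<dots> \<le> norm (E (n + 2 * 1)) + norm (2 * E (n + 1)) + norm (E n)"
      by (meson norm_triangle_ineq norm_triangle_ineq4 add_right_mono order_trans)
    also have "\<dots> = real (n + 2) * g (n + 2) x + (2 * real (n + 1)) * g (n + 1) x + real n * g n x"
      using E[of "n + 2 * 1"] by (simp add: norm_mult E mult.assoc)
    also have "\<dots> \<le> (2 * real (n + 1)) * g (n + 2) x + (2 * real (n + 1)) * g (n + 1) x + (2 * real (n + 1)) * g n x"
      by (intro add_mono) (auto simp: g_def intro!: mult_right_mono)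
    also have "\<dots> = real (n + 1) * (2 * (g (n + 2) x + g (n + 1) x + g n x))"
      by (simp add: algebra_simps)
    \<comment> \<open>The three errors sum to at least 1/2, so one of them is at least 1/6, which
      exceeds 1/8.\<close>
    finally have "1 \<le> 2 * (g (n + 2) x + g (n + 1) x + g n x)"
      by simp
    then show "x \<in> A (n + 2) \<union> A (n + 1) \<union> A n"
      using x by (auto simp: A_def)
  qed
  have "1 = emeasure (Gm m) (space (Gm m))" by (simp add: Gm.emeasure_space_1)
  also have "\<dots> \<le> emeasure (Gm m) (A (n + 2) \<union> A (n + 1) \<union> A n)"
    by (rule emeasure_mono[OF cover]) auto
  also have "\<dots> \<le> emeasure (Gm m) (A (n + 2)) + emeasure (Gm m) (A (n + 1)) + emeasure (Gm m) (A n)"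
    by (meson A_sets add_right_mono emeasure_subadditive order_trans sets.Un)
  finally have "ennreal ((1/8) powr p) * 1 \<le> ennreal ((1/8) powr p) *
      (emeasure (Gm m) (A (n + 2)) + emeasure (Gm m) (A (n + 1)) + emeasure (Gm m) (A n))"
    by (rule mult_left_mono) simp
  also have "\<dots> \<le> W (n + 2) + W (n + 1) + W n"
    unfolding distrib_left by (intro add_mono A_le)
  also have "\<dots> \<le> ennreal \<epsilon> + ennreal \<epsilon> + ennreal \<epsilon>"
    using n_ge by (intro add_mono less_imp_le[OF n0]) auto
  also have "\<dots> = ennreal (3 * \<epsilon>)"
    using \<epsilon> by (simp flip: ennreal_plus)
  finally have "(1/8) powr p \<le> 3 * \<epsilon>" using \<epsilon> by simp
  moreover have "0 < (1/8::real) powr p" by simp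
  ultimately show False by (simp add: \<epsilon>_def)
qed

text \<open>The square root of the second difference is sqrt(M_\<alpha>) h / \<alpha>, and the
  weights sqrt n \<le> 2 sqrt(M_\<alpha>) of the errors cancel its first factor. Summing over
  starting points in the block gives order M_s^2 / \<alpha>.\<close>

lemma fejer_block_lower_bound:
  fixes c :: complex
  assumes x: "x \<in> I s" and s: "2 \<le> s" and \<alpha>: "0 < \<alpha>" and l: "l \<alpha> = 1 / (real \<alpha>)\<^sup>2"
    and w: "M s dvd w" "M \<alpha> \<le> w" "w + M s \<le> 2 * M \<alpha>"
  shows "real (M s) ^ 2 / (128 * real \<alpha>) \<le>
    (\<Sum>v<M s. sqrt (norm (fejer_mean m (shell_mart l) (w + v) x - c)))"
proof -
  define G where "G n = sqrt (norm (fejer_mean m (shell_mart l) n x - c))" for n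
  define E where "E n = of_nat n * (fejer_mean m (shell_mart l) n x - c)" for n
  \<comment> \<open>Since M_s \<ge> 4, h is at least M_s/8, while \<open>T\<close>, the number of v
    with v + 2h < M_s, is at least M_s/2.\<close>
  define h where "h = M s div 4"
  define T where "T = M s - 2 * h"
  have "2 ^ 2 \<le> (2::nat) ^ s" using s by (intro power_increasing) auto
  then have M4: "4 \<le> M s" using two_power_le_M[of s] by simp
  have h: "real (M s) / 8 \<le> real h" "2 * h \<le> M s" and T: "real (M s) / 2 \<le> real T"
  proof -
    have "M s \<le> 8 * h" unfolding h_def using M4 by presburger
    moreover have "4 * h \<le> M s" "M s \<le> 2 * T" by (auto simp: h_def T_def)
    ultimately show "real (M s) / 8 \<le> real h" "2 * h \<le> M s" "real (M s) / 2 \<le> real T"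
      by linarith+
  qed
  have G0: "0 \<le> G n" for n by (simp add: G_def)
  have sqrtE: "sqrt (norm (E n)) \<le> sqrt (real (M \<alpha>)) * (2 * G n)" if "n \<le> 2 * M \<alpha>" for n
  proof -
    have "sqrt (norm (E n)) = sqrt (real n) * G n"
      by (simp add: E_def G_def norm_mult real_sqrt_mult)
    also have "\<dots> \<le> sqrt (4 * real (M \<alpha>)) * G n"
      using that G0 by (intro mult_right_mono) auto
    finally show ?thesis by (simp add: real_sqrt_mult)
  qed
  have step: "real h / real \<alpha> \<le> 2 * (G (w + (v + 2 * h)) + 2 * G (w + (v + h)) + G (w + v))"
    if v: "v < T" for v
  proof -
    have vM: "v + 2 * h < M s" using v by (simp add: T_def)
    have le: "w + M s \<le> M (Suc \<alpha>)"
      using w(3) mult_le_mono1[OF m_ge2[of \<alpha>], of "M \<alpha>"] unfolding M_Suc by linarith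
    have "sqrt (real (M \<alpha>)) * (real h / real \<alpha>) = sqrt (l \<alpha> * real (M \<alpha>) * real h ^ 2)"
      using l \<alpha> by (simp add: real_sqrt_mult real_sqrt_divide)
    also have "l \<alpha> * real (M \<alpha>) * real h ^ 2 = norm (E (w + v + 2 * h) - 2 * E (w + v + h) + E (w + v))"
      unfolding E_def
      by (rule norm_second_difference_fejer[OF x w(1,2) le, symmetric]) (use vM l in auto)
    also have "sqrt \<dots> \<le> sqrt (norm (E (w + v + 2 * h)) + norm (2 * E (w + v + h)) + norm (E (w + v)))"
      by (meson norm_triangle_ineq norm_triangle_ineq4 add_right_mono order_trans real_sqrt_le_mono)
    also have "\<dots> \<le> sqrt (norm (E (w + v + 2 * h))) + sqrt (norm (2 * E (w + v + h))) + sqrt (norm (E (w + v)))"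
      by (meson add_nonneg_nonneg add_right_mono norm_ge_zero order_trans sqrt_add_le_add_sqrt)
    also have "sqrt (norm (2 * E (w + v + h))) \<le> sqrt (4 * norm (E (w + v + h)))"
      by (simp add: norm_mult)
    also have "sqrt (4 * norm (E (w + v + h))) = 2 * sqrt (norm (E (w + v + h)))"
      by (simp add: real_sqrt_mult)
    also have "sqrt (norm (E (w + v + 2 * h))) + 2 * sqrt (norm (E (w + v + h))) + sqrt (norm (E (w + v)))
      \<le> sqrt (real (M \<alpha>)) * (2 * G (w + v + 2 * h)) + 2 * (sqrt (real (M \<alpha>)) * (2 * G (w + v + h)))
         + sqrt (real (M \<alpha>)) * (2 * G (w + v))"
      using vM w by (intro add_mono mult_left_mono sqrtE) auto
    also have "\<dots> = sqrt (real (M \<alpha>)) * (2 * (G (w + (v + 2 * h)) + 2 * G (w + (v + h)) + G (w + v)))"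
      by (simp add: algebra_simps)
    finally show ?thesis by (rule mult_left_le_imp_le) simp_all
  qed
  \<comment> \<open>Shifting by d keeps the indices in the block, and the omitted terms are
    nonnegative. The shifts 2h, h, 0 occur with weights 1, 2, 1, which with the factor 2 from
    \<open>step\<close> gives 8 block sums and turns 16 into 128.\<close>
  have shift: "(\<Sum>v<T. G (w + (v + d))) \<le> (\<Sum>v<M s. G (w + v))" if "d \<le> 2 * h" for d
  proof -
    have "(\<Sum>v<T. G (w + (v + d))) = (\<Sum>v\<in>(\<lambda>v. v + d) ` {..<T}. G (w + v))"
      by (simp add: sum.reindex)
    also have "\<dots> \<le> (\<Sum>v<M s. G (w + v))"
      using that h G0 by (intro sum_mono2) (auto simp: T_def)
    finally show ?thesis .
  qed
  have "real (M s) ^ 2 / (16 * real \<alpha>) = (real (M s) / 2) * ((real (M s) / 8) / real \<alpha>)"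
    by (simp add: power2_eq_square)
  also have "\<dots> \<le> real T * (real h / real \<alpha>)"
    using h T by (intro mult_mono divide_right_mono) auto
  also have "\<dots> = (\<Sum>v<T. real h / real \<alpha>)" by simp
  also have "\<dots> \<le> (\<Sum>v<T. 2 * (G (w + (v + 2 * h)) + 2 * G (w + (v + h)) + G (w + v)))"
    by (intro sum_mono step) auto
  also have "\<dots> = 2 * ((\<Sum>v<T. G (w + (v + 2 * h))) + 2 * (\<Sum>v<T. G (w + (v + h))) + (\<Sum>v<T. G (w + (v + 0))))"
    by (simp add: sum.distrib sum_distrib_left)
  also have "\<dots> \<le> 2 * ((\<Sum>v<M s. G (w + v)) + 2 * (\<Sum>v<M s. G (w + v)) + (\<Sum>v<M s. G (w + v)))"
    by (intro mult_left_mono add_mono shift) auto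
  finally have "real (M s) ^ 2 / (16 * real \<alpha>) \<le> 8 * (\<Sum>v<M s. G (w + v))" by simp
  then show ?thesis unfolding G_def by (simp add: field_simps)
qed

text \<open>M_s divides M_\<alpha>, so [M_\<alpha>, 2 M_\<alpha>) splits into M_\<alpha> / M_s
  blocks of length M_s, to each of which \<open>fejer_block_lower_bound\<close> applies.\<close>

lemma fejer_average_lower_bound:
  fixes c :: complex
  assumes x: "x \<in> I s" and s: "2 \<le> s" "s \<le> \<alpha>" and \<alpha>: "0 < \<alpha>" and l: "l \<alpha> = 1 / (real \<alpha>)\<^sup>2"
  shows "real (M \<alpha>) * real (M s) / (128 * real \<alpha>) \<le>
    (\<Sum>q<M \<alpha>. sqrt (norm (fejer_mean m (shell_mart l) (M \<alpha> + q) x - c)))"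
proof -
  obtain d where d: "M \<alpha> = d * M s"
    using M_dvd[OF s(2)] by (metis dvdE mult.commute)
  define G where "G n = sqrt (norm (fejer_mean m (shell_mart l) n x - c))" for n
  have "real (M \<alpha>) * real (M s) / (128 * real \<alpha>) = (\<Sum>a<d. real (M s) ^ 2 / (128 * real \<alpha>))"
    by (simp add: d power2_eq_square)
  also have "\<dots> \<le> (\<Sum>a<d. \<Sum>v<M s. G (M \<alpha> + a * M s + v))"
  proof (intro sum_mono)
    fix a assume a: "a \<in> {..<d}"
    have "Suc a * M s \<le> M \<alpha>" unfolding d using a by (intro mult_right_mono) auto
    then show "real (M s) ^ 2 / (128 * real \<alpha>) \<le> (\<Sum>v<M s. G (M \<alpha> + a * M s + v))"
      unfolding G_def by (intro fejer_block_lower_bound[where l=l, OF x s(1) \<alpha> l]) (auto simp: d)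
  qed
  also have "\<dots> = (\<Sum>q<d * M s. G (M \<alpha> + q))"
    by (simp add: sum_blocks add.assoc)
  finally show ?thesis by (simp add: G_def d)
qed

lemma measure_shell_ge: "1 / (2 * real (M s)) \<le> measure (Gm m) (I s - I (Suc s))"
proof -
  have "1 / real (M (Suc s)) \<le> 1 / (2 * real (M s))"
    using m_ge2[of s] by (intro divide_left_mono) (auto simp: M_Suc)
  moreover have "measure (Gm m) (I s - I (Suc s)) = 1 / real (M s) - 1 / real (M (Suc s))"
    by (subst Gm.finite_measure_Diff) (auto simp: measure_I mem_I)
  moreover have "1 / (2 * real (M s)) = 1 / real (M s) / 2" by simp
  ultimately show ?thesis by linarith
qed

text \<open>On shell s the sum over q is at least \<open>\<kappa> s\<close>, and the shell has
  measure at least 1/(2 M_s). The product M_\<alpha> / (256 \<alpha>) does not depend on s, so the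
  \<alpha> - 2 shells contribute equally.\<close>

lemma fejer_integral_lower_bound:
  assumes f [measurable]: "f \<in> borel_measurable (Gm m)"
    and \<alpha>: "4 \<le> \<alpha>" and l: "l \<alpha> = 1 / (real \<alpha>)\<^sup>2"
  shows "ennreal (real (M \<alpha>) / 512) \<le>
    (\<Sum>q<M \<alpha>. \<integral>\<^sup>+x. ennreal (sqrt (norm (fejer_mean m (shell_mart l) (M \<alpha> + q) x - f x))) \<partial>Gm m)"
proof -
  define G where "G n x = sqrt (norm (fejer_mean m (shell_mart l) n x - f x))" for n x
  have G_meas [measurable]: "G n \<in> borel_measurable (Gm m)" for n
    unfolding G_def[abs_def] by measurable
  define \<kappa> where "\<kappa> s = real (M \<alpha>) * real (M s) / (128 * real \<alpha>)" for s
  have \<kappa>: "0 \<le> \<kappa> s" for s by (simp add: \<kappa>_def)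
  \<comment> \<open>The shells are disjoint, so at most one summand on the left is nonzero at a
    given point.\<close>
  have pointwise: "(\<Sum>s=2..<\<alpha>. ennreal (\<kappa> s) * indicator (I s - I (Suc s)) x) \<le> (\<Sum>q<M \<alpha>. ennreal (G (M \<alpha> + q) x))"
    if x: "x \<in> space (Gm m)" for x
  proof (cases "\<exists>s\<in>{2..<\<alpha>}. x \<in> I s - I (Suc s)")
    case True
    then obtain s where s: "s \<in> {2..<\<alpha>}" "x \<in> I s - I (Suc s)" by blast
    have "x \<in> I t - I (Suc t) \<longleftrightarrow> t = s" for t
    proof
      assume t: "x \<in> I t - I (Suc t)"
      show "t = s"
      proof (rule ccontr)
        assume "t \<noteq> s"
        then have "Suc t \<le> s \<or> Suc s \<le> t" by auto
        then show False using s t by (auto simp: mem_I)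
      qed
    qed (use s in auto)
    then have "(\<Sum>s=2..<\<alpha>. ennreal (\<kappa> s) * indicator (I s - I (Suc s)) x) = (\<Sum>t=2..<\<alpha>. if t = s then ennreal (\<kappa> t) else 0)"
      by (intro sum.cong) (auto simp: indicator_def)
    also have "\<dots> = ennreal (\<kappa> s)" using s by simp
    also have "\<dots> \<le> ennreal (\<Sum>q<M \<alpha>. G (M \<alpha> + q) x)"
      unfolding \<kappa>_def G_def using s \<alpha> l by (intro ennreal_leI fejer_average_lower_bound) auto
    also have "\<dots> = (\<Sum>q<M \<alpha>. ennreal (G (M \<alpha> + q) x))"
      by (simp add: sum_ennreal G_def)
    finally show ?thesis .
  next
    case False
    then have "(\<Sum>s=2..<\<alpha>. ennreal (\<kappa> s) * indicator (I s - I (Suc s)) x) = 0"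
      by (intro sum.neutral) (auto simp: indicator_def)
    then show ?thesis by simp
  qed
  have "real (M \<alpha>) / 512 \<le> real (\<alpha> - 2) * (real (M \<alpha>) / (256 * real \<alpha>))"
  proof -
    \<comment> \<open>Here \<alpha> \<ge> 4 enters: at least half of \<alpha> many shells are
      available.\<close>
    have "real \<alpha> / 2 \<le> real (\<alpha> - 2)" using \<alpha> by (simp add: of_nat_diff)
    then have "real \<alpha> / 2 * (real (M \<alpha>) / (256 * real \<alpha>)) \<le> real (\<alpha> - 2) * (real (M \<alpha>) / (256 * real \<alpha>))"
      by (intro mult_right_mono) auto
    then show ?thesis using \<alpha> by simp
  qed
  then have "ennreal (real (M \<alpha>) / 512) \<le> ennreal (\<Sum>s=2..<\<alpha>. real (M \<alpha>) / (256 * real \<alpha>))"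
    by (intro ennreal_leI) simp
  also have "\<dots> \<le> ennreal (\<Sum>s=2..<\<alpha>. \<kappa> s * measure (Gm m) (I s - I (Suc s)))"
  proof (intro ennreal_leI sum_mono)
    fix s
    have "real (M \<alpha>) / (256 * real \<alpha>) = \<kappa> s * (1 / (2 * real (M s)))"
      by (simp add: \<kappa>_def)
    also have "\<dots> \<le> \<kappa> s * measure (Gm m) (I s - I (Suc s))"
      by (intro mult_left_mono measure_shell_ge \<kappa>)
    finally show "real (M \<alpha>) / (256 * real \<alpha>) \<le> \<kappa> s * measure (Gm m) (I s - I (Suc s))" .
  qed
  also have "\<dots> = (\<Sum>s=2..<\<alpha>. ennreal (\<kappa> s) * emeasure (Gm m) (I s - I (Suc s)))"
    by (simp add: Gm.emeasure_eq_measure \<kappa> sum_ennreal flip: ennreal_mult)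
  also have "\<dots> = (\<integral>\<^sup>+x. (\<Sum>s=2..<\<alpha>. ennreal (\<kappa> s) * indicator (I s - I (Suc s)) x) \<partial>Gm m)"
    by (subst nn_integral_sum) (auto simp: nn_integral_cmult_indicator)
  also have "\<dots> \<le> (\<integral>\<^sup>+x. (\<Sum>q<M \<alpha>. ennreal (G (M \<alpha> + q) x)) \<partial>Gm m)"
    by (intro nn_integral_mono pointwise)
  also have "\<dots> = (\<Sum>q<M \<alpha>. \<integral>\<^sup>+x. ennreal (G (M \<alpha> + q) x) \<partial>Gm m)"
    by (rule nn_integral_sum) measurable
  finally show ?thesis by (simp add: G_def)
qed

text \<open>The mean of the integrals over M_\<alpha> \<le> n < 2 M_\<alpha> is at least 1/512, so
  they cannot all be at most 1/1024 from some index on.\<close>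

lemma L_half_fejer_not_tendsto_0:
  assumes f: "f \<in> borel_measurable (Gm m)"
    and l: "\<And>i. l (2 ^ i) = 1 / (real (2 ^ i))\<^sup>2"
  shows "\<not> (\<lambda>n. Lp_norm m (1/2) (\<lambda>x. fejer_mean m (shell_mart l) n x - f x)) \<longlonglongrightarrow> 0"
proof
  define J where "J n = (\<integral>\<^sup>+x. ennreal (sqrt (norm (fejer_mean m (shell_mart l) n x - f x))) \<partial>Gm m)" for n
  assume lim: "(\<lambda>n. Lp_norm m (1/2) (\<lambda>x. fejer_mean m (shell_mart l) n x - f x)) \<longlonglongrightarrow> 0"
  have Lp: "Lp_norm m (1/2) (\<lambda>x. fejer_mean m (shell_mart l) n x - f x) = enn_powr (J n) 2" for n
    by (simp add: Lp_norm_def J_def powr_half_sqrt)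
  have "eventually (\<lambda>n. enn_powr (J n) 2 < ennreal ((1/1024) powr 2)) sequentially"
    using lim unfolding Lp by (rule order_tendstoD) (simp add: ennreal_less_zero_iff)
  then obtain n0 where n0: "\<And>n. n0 \<le> n \<Longrightarrow> enn_powr (J n) 2 < ennreal ((1/1024) powr 2)"
    by (auto simp: eventually_sequentially)
  have J: "J n \<le> ennreal (1/1024)" if "n0 \<le> n" for n
  proof (cases "J n")
    case (real t)
    then have "t powr 2 < (1/1024) powr 2"
      using n0[OF that] by (simp add: enn_powr_def ennreal_less_iff)
    then have "t \<le> 1/1024"
      using real(1) powr_mono2[of 2 "1/1024" t] by (meson less_le_not_le nle_le zero_le_numeral zero_le_divide_1_iff)
    then show ?thesis using real by (auto intro: ennreal_leI)
  next
    case top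
    then show ?thesis using n0[OF that] by (simp add: enn_powr_def)
  qed
  \<comment> \<open>A power of two, where \<open>l\<close> is known. The exponent makes it at least
    4 and puts M_\<alpha> beyond \<open>n0\<close>.\<close>
  define \<alpha> :: nat where "\<alpha> = 2 ^ (n0 + 2)"
  have \<alpha>4: "4 \<le> \<alpha>" by (simp add: \<alpha>_def)
  have "n0 < 2 ^ n0" by (rule less_exp)
  also have "\<dots> \<le> \<alpha>" by (simp add: \<alpha>_def)
  also have "\<dots> < M \<alpha>" by (rule less_M)
  finally have n0_le: "n0 \<le> M \<alpha>" by simp
  have "ennreal (real (M \<alpha>) / 512) \<le> (\<Sum>q<M \<alpha>. J (M \<alpha> + q))"
    unfolding J_def using fejer_integral_lower_bound[OF f \<alpha>4] l[of "n0 + 2"] by (simp add: \<alpha>_def)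
  also have "\<dots> \<le> (\<Sum>q<M \<alpha>. ennreal (1/1024))"
    using n0_le by (intro sum_mono J) auto
  also have "\<dots> = ennreal (\<Sum>q<M \<alpha>. 1/1024)"
    by (rule sum_ennreal) simp
  finally show False by (simp add: ennreal_le_iff)
qed

section \<open>The two counterexamples\<close>

text \<open>With l = 1 the k-th term of the norm series is B^p M_k^(2p-1). As 2p-1 < 0 and M_{k+N}
  \<ge> 2^k M_N, a geometric series of ratio 2^(2p-1) dominates the tail, with a factor M_N^(2p-1)
  whose (1/p)-th power is the required rate.\<close>

lemma weak_Lp_counterexample:
  assumes B: "\<And>k. real (m k) \<le> B" and p: "0 < p" "p < 1/2"
  shows "\<exists>F f. is_martingale m F \<and> Hp_norm m p F < \<infinity> \<and>
          f \<in> borel_measurable (Gm m) \<and>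
          (AE x in Gm m. (\<lambda>k. F k x) \<longlonglongrightarrow> f x) \<and>
          (\<exists>C::real. \<forall>\<^sub>F N in sequentially.
             modulus_Hp m p N F \<le> ennreal (C / real (M N) powr (1/p - 2))) \<and>
          \<not> ((\<lambda>n. weak_Lp_norm m p (\<lambda>x. fejer_mean m F n x - f x)) \<longlonglongrightarrow> 0)"
proof -
  define l :: "nat \<Rightarrow> real" where "l = (\<lambda>_. 1)"
  define r where "r = 2 powr (2 * p - 1)"
  have r: "0 < r" "r < 1"
    using p by (auto simp: r_def powr_less_one)
  have B0: "0 \<le> B" using B[of 0] by (rule order_trans[rotated]) simp
  define a where "a N k = B powr p * real (M N) powr (2 * p - 1) * r ^ k" for N k
  have a: "(l (k + N) * B * real (M (k + N)) ^ 2) powr p / real (M (k + N)) \<le> a N k" for N k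
  proof -
    have "(l (k + N) * B * real (M (k + N)) ^ 2) powr p / real (M (k + N)) =
        B powr p * (real (M (k + N)) powr (2 * p) / real (M (k + N)))"
      using B0 by (simp add: l_def powr_mult powr_powr flip: powr_numeral)
    also have "\<dots> = B powr p * real (M (k + N)) powr (2 * p - 1)"
      by (simp add: powr_diff)
    also have "\<dots> \<le> B powr p * (2 ^ k * real (M N)) powr (2 * p - 1)"
    proof (intro mult_left_mono powr_mono2')
      have "real (2 ^ k * M N) \<le> real (M (k + N))"
        using M_add_ge[of k N] by (simp only: of_nat_le_iff add.commute)
      then show "2 ^ k * real (M N) \<le> real (M (k + N))" by simp
    qed (use p in auto)
    also have "\<dots> = a N k"
      by (simp add: a_def r_def powr_mult powr_power powr_powr mult_ac flip: powr_realpow)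
    finally show ?thesis .
  qed
  have sums: "a N sums (B powr p * real (M N) powr (2 * p - 1) * (1 / (1 - r)))" for N
    unfolding a_def using r by (intro sums_mult geometric_sums) auto
  define C where "C = (B powr p * (1 / (1 - r))) powr (1 / p)"
  have modulus: "modulus_Hp m p N (shell_mart l) \<le> ennreal (C / real (M N) powr (1/p - 2))" for N
  proof -
    have "modulus_Hp m p N (shell_mart l) \<le>
        ennreal ((B powr p * real (M N) powr (2 * p - 1) * (1 / (1 - r))) powr (1 / p))"
      by (rule modulus_shell_mart_le[OF _ _ _ B a sums]) (use p in \<open>auto simp: l_def\<close>)
    also have "(B powr p * real (M N) powr (2 * p - 1) * (1 / (1 - r))) powr (1 / p) =
        C * (real (M N) powr (2 * p - 1)) powr (1 / p)"
      unfolding C_def using r by (simp add: powr_mult powr_divide)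
    also have "(real (M N) powr (2 * p - 1)) powr (1 / p) = real (M N) powr (- (1 / p - 2))"
    proof -
      have "(2 * p - 1) * (1 / p) = - (1 / p - 2)" using p by (simp add: field_simps)
      then show ?thesis by (simp only: powr_powr)
    qed
    finally show ?thesis by (simp only: powr_minus_divide) simp
  qed
  have Hp: "Hp_norm m p (shell_mart l) < \<infinity>"
    by (rule Hp_norm_shell_mart_finite[OF _ _ _ B, where a="a 0"])
      (use p a[of _ 0] sums[of 0] in \<open>auto simp: l_def summable_def\<close>)
  \<comment> \<open>The function f is the pointwise limit, which exists away from the point
    0.\<close>
  show ?thesis
    using is_martingale_shell_mart Hp AE_shell_mart_converges modulus
      weak_fejer_not_tendsto_0[OF borel_measurable_lim_metric[OF measurable_shell_mart]]
    by (intro exI[of _ "shell_mart l"] exI[of _ "\<lambda>x. lim (\<lambda>n. shell_mart l n x)"])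
      (auto simp: l_def intro!: borel_measurable_lim_metric always_eventually)
qed

text \<open>For p = 1/2 the powers of M_k cancel in the norm series and sqrt(B l_k) remains. The
  rate thus comes from the tail of the series of sqrt(l_k), which is of order 1/N.\<close>

lemma L_half_counterexample:
  assumes B: "\<And>k. real (m k) \<le> B"
  shows "\<exists>F f. is_martingale m F \<and> Hp_norm m (1/2) F < \<infinity> \<and>
          f \<in> borel_measurable (Gm m) \<and>
          (AE x in Gm m. (\<lambda>k. F k x) \<longlonglongrightarrow> f x) \<and>
          (\<exists>C::real. \<forall>\<^sub>F N in sequentially.
             modulus_Hp m (1/2) N F \<le> ennreal (C / (real N)^2)) \<and>
          \<not> ((\<lambda>n. Lp_norm m (1/2) (\<lambda>x. fejer_mean m F n x - f x)) \<longlonglongrightarrow> 0)"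
proof -
  \<comment> \<open>This is the sum of 2^(-i) over all i with 2^i \<ge> N, the tail of the series of
    square roots of \<open>l\<close>.\<close>
  define g :: "nat \<Rightarrow> real" where "g N = 2 / 2 ^ pow2_ceil_exp N" for N
  \<comment> \<open>\<open>l k = 1 / k\<^sup>2\<close> at powers of two and \<open>0\<close> elsewhere, in a form that makes the sum of the
    square roots telescope\<close>
  define l where "l k = (g k - g (Suc k))\<^sup>2" for k
  have B0: "0 \<le> B" using B[of 0] by (rule order_trans[rotated]) simp
  have g0: "0 \<le> g N" for N by (simp add: g_def)
  have g_le: "g N \<le> 2 / real N" if "0 < N" for N
  proof -
    have "real N \<le> real (2 ^ pow2_ceil_exp N)"
      using le_pow2_ceil_exp[of N] by (simp only: of_nat_le_iff)
    then show ?thesis unfolding g_def using that by (intro divide_left_mono) auto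
  qed
  \<comment> \<open>Monotonicity makes the square root of \<open>l k\<close> the difference itself,
    so that the series telescopes.\<close>
  have g_decr: "g (Suc N) \<le> g N" for N
  proof -
    have "pow2_ceil_exp N \<le> pow2_ceil_exp (Suc N)"
      using le_pow2_ceil_exp[of "Suc N"] by (intro pow2_ceil_exp_le) simp
    then show ?thesis by (auto simp: g_def intro!: divide_left_mono power_increasing)
  qed
  have g_lim: "g \<longlonglongrightarrow> 0"
    by (rule real_tendsto_sandwich[OF _ _ tendsto_const lim_const_over_n[of 2]])
      (auto simp: g0 intro!: eventually_sequentiallyI[of 1] g_le)
  define a where "a N k = sqrt B * (g (k + N) - g (Suc (k + N)))" for N k
  have a: "(l (k + N) * B * real (M (k + N)) ^ 2) powr (1/2) / real (M (k + N)) \<le> a N k" for N k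
    using B0 g_decr[of "k + N"]
    by (simp add: powr_half_sqrt l_def a_def real_sqrt_mult)
  have sums: "a N sums (sqrt B * g N)" for N
  proof -
    have "(\<lambda>k. g (k + N)) \<longlonglongrightarrow> 0" using g_lim by (rule LIMSEQ_ignore_initial_segment)
    from telescope_sums'[OF this] show ?thesis
      unfolding a_def by (intro sums_mult) simp
  qed
  have modulus: "modulus_Hp m (1/2) N (shell_mart l) \<le> ennreal (4 * B / (real N)\<^sup>2)" if "1 \<le> N" for N
  proof -
    have "modulus_Hp m (1/2) N (shell_mart l) \<le> ennreal ((sqrt B * g N) powr (1 / (1/2)))"
      by (rule modulus_shell_mart_le[OF _ _ _ B a sums]) (auto simp: l_def)
    also have "(sqrt B * g N) powr (1 / (1/2)) = (sqrt B * g N) ^ 2"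
      using B0 g0[of N] by simp
    also have "\<dots> = B * (g N)\<^sup>2" using B0 by (simp add: power_mult_distrib)
    also have "\<dots> \<le> B * (2 / real N)\<^sup>2"
      using B0 g0 g_le[of N] that by (intro mult_left_mono power_mono) auto
    finally show ?thesis by (simp add: power_divide mult.commute ennreal_leI)
  qed
  have Hp: "Hp_norm m (1/2) (shell_mart l) < \<infinity>"
    by (rule Hp_norm_shell_mart_finite[OF _ _ _ B, where a="a 0"])
      (use a[of _ 0] sums[of 0] in \<open>auto simp: l_def summable_def\<close>)
  have l_pow: "l (2 ^ i) = 1 / (real (2 ^ i))\<^sup>2" for i
    by (simp add: l_def g_def pow2_ceil_exp_eqs power_divide)
  show ?thesis
    using is_martingale_shell_mart Hp AE_shell_mart_converges modulus
      L_half_fejer_not_tendsto_0[where l=l, OF borel_measurable_lim_metric[OF measurable_shell_mart] l_pow]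
    by (intro exI[of _ "shell_mart l"] exI[of _ "\<lambda>x. lim (\<lambda>n. shell_mart l n x)"])
      (auto intro!: borel_measurable_lim_metric exI[of _ "4 * B"] eventually_sequentiallyI[of 1])
qed

end

theorem theorem2:
  fixes m :: "nat \<Rightarrow> nat"
  assumes m_ge2: "\<And>k. 2 \<le> m k"
    and m_bdd: "\<exists>B. \<forall>k. m k \<le> B"
  shows
    "(\<forall>p::real. 0 < p \<and> p < 1/2 \<longrightarrow>
       (\<exists>F f. is_martingale m F \<and> Hp_norm m p F < \<infinity> \<and>
          f \<in> borel_measurable (Gm m) \<and>
          (AE x in Gm m. (\<lambda>k. F k x) \<longlonglongrightarrow> f x) \<and>
          (\<exists>C::real. \<forall>\<^sub>F N in sequentially.
             modulus_Hp m p N F \<le> ennreal (C / real (Mseq m N) powr (1/p - 2))) \<and>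
          \<not> ((\<lambda>n. weak_Lp_norm m p (\<lambda>x. fejer_mean m F n x - f x)) \<longlonglongrightarrow> 0)))
     \<and>
     (\<exists>F f. is_martingale m F \<and> Hp_norm m (1/2) F < \<infinity> \<and>
          f \<in> borel_measurable (Gm m) \<and>
          (AE x in Gm m. (\<lambda>k. F k x) \<longlonglongrightarrow> f x) \<and>
          (\<exists>C::real. \<forall>\<^sub>F N in sequentially.
             modulus_Hp m (1/2) N F \<le> ennreal (C / (real N)^2)) \<and>
          \<not> ((\<lambda>n. Lp_norm m (1/2) (\<lambda>x. fejer_mean m F n x - f x)) \<longlonglongrightarrow> 0))"
proof -
  interpret vilenkin_group m by standard (rule m_ge2)
  from m_bdd obtain B :: nat where "\<And>k. m k \<le> B" by blast
  then have B: "real (m k) \<le> real B" for k by simp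
  show ?thesis
    using weak_Lp_counterexample[OF B] L_half_counterexample[OF B] by (intro conjI allI impI) (elim conjE)
qed

end
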